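(* Let $c>1$ be real, $N\ge0$ an integer, $L=\log c$. The limit $Q_{{\rm arch},\infty}=\lim_{T\to\infty}Q_{{\rm arch},T}$ exists entrywise, and $Q_\infty:=Q_{\rm prime}^{(c)}+Q_{\rm pole}+Q_{{\rm arch},\infty}$ is the Galerkin matrix of the Weil quadratic form: for every $v=(v_0,\dots,v_N)\in\mathbb R^{N+1}$, $$\langle v,Q_\infty v\rangle=W_{0,2}(F_v)-W_{\mathbb R}(F_v)-W_{\rm prime}(F_v),\qquad F_v(x)=q(f_v,f_v)(\log x),$$ where $f_v=\sum_{m\in I_N}u_mU_m$ is the trigonometric polynomial with coefficient vector $u$ on the interval of length $L$. In particular $-Q_{\rm prime}^{(c)}$, $Q_{\rm pole}$ and $-Q_{{\rm arch},\infty}$ are respectively the prime, pole and archimedean blocks of the Galerkin matrix, i.e. with $F_{mn}(x)=q(U_m,U_n)(\log x)$, for all $m,n\in I_N$, $$-(Q_{\rm prime}^{(c)})_{mn}=W_{\rm prime}(F_{mn}),\qquad (Q_{\rm pole})_{mn}=W_{0,2}(F_{mn}),\qquad -(Q_{{\rm arch},\infty})_{mn}=W_{\mathbb R}(F_{mn}).$$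
   Context: Notation. $I_N=\{-N,\dots,N\}$. A vector $v\in\mathbb R^{N+1}$ is embedded into symmetric coefficients $u=(u_m)_{m\in I_N}$ by $u_0=v_0$, $u_k=u_{-k}=v_k/\sqrt2$ for $1\le k\le N$. For any matrix $Q$ indexed by $I_N\times I_N$, $\langle v,Qv\rangle:=\sum_{m,n=-N}^N u_mu_nQ_{mn}$. For a $C^1$ function $\psi$ on $\mathbb R$, $Q_\psi$ is the matrix indexed by $I_N\times I_N$ with $(Q_\psi)_{mn}=\frac{\psi(m)-\psi(n)}{m-n}$ for $m\ne n$ and $(Q_\psi)_{mm}=\psi'(m)$. Let $\Lambda$ be the von Mangoldt function; sums over $q=p^a$ run over prime powers with $a\ge1$. Let $\psi_\Gamma=\Gamma'/\Gamma$ be the digamma function and $h_+(r)=\operatorname{Re}\psi_\Gamma(\tfrac14+\tfrac{ir}2)-\log\pi$. Define $$\psi_p^{(c)}(x)=-\frac1\pi\sum_{q=p^a\le c}\frac{\Lambda(q)}{\sqrt q}\sin\!\Bigl(2\pi x\bigl(1-\tfrac{\log q}{L}\bigr)\Bigr),$$ $$\psi_0(x)=\frac1\pi\int_0^L2\cosh(y/2)\sin\!\bigl(2\pi x(1-\tfrac yL)\bigr)\,dy,$$ $$\psi_{\mathbb R,T}(x)=\frac1{2\pi^2}\int_{-T}^Th_+(r)\,\mathcal S(r,x,L)\,dr,\qquad \mathcal S(r,x,L)=\int_0^L\sin\!\bigl(2\pi x(1-\tfrac yL)\bigr)\cos(ry)\,dy ,$$ and $Q_{\rm prime}^{(c)}=Q_{\psi_p^{(c)}}$,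 $Q_{\rm pole}=Q_{\psi_0}$, $Q_{{\rm arch},T}=Q_{\psi_{\mathbb R,T}}$. The Weil quadratic form (standard conventions). Let $U_n(t)=L^{-1/2}e^{2\pi int/L}$ for $t\in[0,L]$ and $U_n(t)=0$ otherwise ($n\in I_N$). For $f,g$ in the span of the $U_n$ let $q(f,g)(y)=\int_{\mathbb R}\overline{f(t)}\,g(t+y)\,dt$ for $y\in\mathbb R$. For a function $F$ on $(0,\infty)$ of the form $F(x)=q(f,g)(\log x)$ (so $F$ is supported in $[c^{-1},c]$) put $$W_{0,2}(F)=\int_0^\infty F(x)\,(x^{1/2}+x^{-1/2})\,\frac{dx}x,$$ $$W_{\rm prime}(F)=\sum_{q=p^a}\frac{\Lambda(q)}{\sqrt q}\bigl(F(q)+F(q^{-1})\bigr),$$ $$W_{\mathbb R}(F)=(\log4\pi+\gamma)F(1)+\int_1^\infty\bigl(F(x)+F(x^{-1})-2x^{-1/2}F(1)\bigr)\frac{x^{1/2}}{x-x^{-1}}\,\frac{dx}x,$$ where $\gamma$ is Euler's constant. *)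

theory Defs
  imports "HOL-Analysis.Analysis" "HOL-Number_Theory.Prime_Powers"
begin

text \<open>Throughout, matrices indexed by \<open>I_N \<times> I_N\<close> are functions on pairs of integers, of which
  only the entries with both indices in \<open>idx N\<close> matter.\<close>

definition idx :: "nat \<Rightarrow> int set" where
  "idx N = {- int N..int N}"

text \<open>A vector of \<open>\<real>\<^sup>N\<^sup>+\<^sup>1\<close> is a function on the naturals; only the components
  \<open>v 0, \<dots>, v N\<close> are accessed by the definitions below.\<close>

definition sym_coeff :: "(nat \<Rightarrow> real) \<Rightarrow> int \<Rightarrow> real" where
  "sym_coeff v m = (if m = 0 then v 0 else v (nat \<bar>m\<bar>) / sqrt 2)"

definition quad_form :: "nat \<Rightarrow> (nat \<Rightarrow> real) \<Rightarrow> (int \<Rightarrow> int \<Rightarrow> real) \<Rightarrow> real" where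
  "quad_form N v Q = (\<Sum>m\<in>idx N. \<Sum>n\<in>idx N. sym_coeff v m * sym_coeff v n * Q m n)"

definition Q_of :: "(real \<Rightarrow> real) \<Rightarrow> int \<Rightarrow> int \<Rightarrow> real" where
  "Q_of \<psi> m n =
     (if m = n then deriv \<psi> (of_int m)
      else (\<psi> (of_int m) - \<psi> (of_int n)) / (of_int m - of_int n))"

definition h_plus :: "real \<Rightarrow> real" where
  "h_plus r = Re (Digamma (1 / 4 + \<i> * of_real r / 2)) - ln pi"

definition psi_prime :: "real \<Rightarrow> real \<Rightarrow> real \<Rightarrow> real" where
  "psi_prime c L x =
     - (1 / pi) * (\<Sum>q | primepow q \<and> real q \<le> c.
         mangoldt q / sqrt (real q) * sin (2 * pi * x * (1 - ln (real q) / L)))"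

definition psi_pole :: "real \<Rightarrow> real \<Rightarrow> real" where
  "psi_pole L x =
     1 / pi * (LBINT y:{0..L}. 2 * cosh (y / 2) * sin (2 * pi * x * (1 - y / L)))"

definition S_kernel :: "real \<Rightarrow> real \<Rightarrow> real \<Rightarrow> real" where
  "S_kernel r x L = (LBINT y:{0..L}. sin (2 * pi * x * (1 - y / L)) * cos (r * y))"

definition psi_arch :: "real \<Rightarrow> real \<Rightarrow> real \<Rightarrow> real" where
  "psi_arch L T x = 1 / (2 * pi\<^sup>2) * (LBINT r:{-T..T}. h_plus r * S_kernel r x L)"

definition Q_prime :: "real \<Rightarrow> real \<Rightarrow> int \<Rightarrow> int \<Rightarrow> real" where
  "Q_prime c L = Q_of (psi_prime c L)"

definition Q_pole :: "real \<Rightarrow> int \<Rightarrow> int \<Rightarrow> real" where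
  "Q_pole L = Q_of (psi_pole L)"

definition Q_arch :: "real \<Rightarrow> real \<Rightarrow> int \<Rightarrow> int \<Rightarrow> real" where
  "Q_arch L T = Q_of (psi_arch L T)"

text \<open>The entrywise limit for \<open>T \<rightarrow> \<infinity>\<close>; \<open>Lim\<close> is unspecified when the limit does not exist.\<close>

definition Q_arch_inf :: "real \<Rightarrow> int \<Rightarrow> int \<Rightarrow> real" where
  "Q_arch_inf L m n = Lim at_top (\<lambda>T. Q_arch L T m n)"

definition Q_inf :: "real \<Rightarrow> real \<Rightarrow> int \<Rightarrow> int \<Rightarrow> real" where
  "Q_inf c L m n = Q_prime c L m n + Q_pole L m n + Q_arch_inf L m n"

definition U :: "real \<Rightarrow> int \<Rightarrow> real \<Rightarrow> complex" where
  "U L n t =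
     (if t \<in> {0..L}
      then of_real (L powr (- 1 / 2)) * exp (2 * of_real pi * \<i> * of_int n * of_real t / of_real L)
      else 0)"

definition corr :: "(real \<Rightarrow> complex) \<Rightarrow> (real \<Rightarrow> complex) \<Rightarrow> real \<Rightarrow> complex" where
  "corr f g y = (LBINT t. cnj (f t) * g (t + y))"

definition corr_mult :: "(real \<Rightarrow> complex) \<Rightarrow> (real \<Rightarrow> complex) \<Rightarrow> real \<Rightarrow> complex" where
  "corr_mult f g x = corr f g (ln x)"

definition trig_poly :: "nat \<Rightarrow> real \<Rightarrow> (nat \<Rightarrow> real) \<Rightarrow> real \<Rightarrow> complex" where
  "trig_poly N L v t = (\<Sum>m\<in>idx N. of_real (sym_coeff v m) * U L m t)"

definition W_pole :: "(real \<Rightarrow> complex) \<Rightarrow> complex" where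
  "W_pole F = (LBINT x:{0<..}. F x * of_real ((x powr (1 / 2) + x powr (- 1 / 2)) / x))"

definition W_prime :: "(real \<Rightarrow> complex) \<Rightarrow> complex" where
  "W_prime F = (\<Sum>\<^sub>\<infinity>q\<in>{q. primepow q}.
     of_real (mangoldt q / sqrt (real q)) * (F (real q) + F (inverse (real q))))"

definition W_real :: "(real \<Rightarrow> complex) \<Rightarrow> complex" where
  "W_real F =
     of_real (ln (4 * pi) + euler_mascheroni) * F 1 +
     (LBINT x:{1<..}. (F x + F (inverse x) - 2 * of_real (x powr (- 1 / 2)) * F 1) *
        of_real (x powr (1 / 2) / (x - inverse x) / x))"

end

theory Submission
  imports Defs "HOL-Probability.Sinc_Integral"
begin

text \<open>
  Fix indices \<open>m\<close>, \<open>n\<close> and let \<open>C\<close> be the correlation of \<open>U L m\<close> and \<open>U L n\<close>. In the variable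
  \<open>y = ln x\<close> all three functionals see \<open>C\<close> only through its value at \<open>0\<close> and the folded
  correlation \<open>C y + C (- y)\<close> with \<open>y > 0\<close>. A direct integration shows that the folded correlation is real
  and equals, for \<open>0 \<le> y \<le> L\<close>, the divided difference at \<open>(m, n)\<close> of the function
  \<open>x \<mapsto> sin (2 \<pi> x (1 - y / L)) / \<pi>\<close> (\<open>corr_fold\<close>), while it vanishes for \<open>y > L\<close>. Each of the functions
  defining the matrices is a superposition of these sines over \<open>y\<close>: a sum over prime
  powers, an integral against \<open>2 cosh (y / 2)\<close>, and an integral against the truncated cosine integral
  of \<open>h_plus\<close>. Divided differences are linear (\<open>Q_of_sine_integral\<close>), so each matrix
  entry is the same superposition of the folded correlation. For the prime and pole blocks
  this is already the claim.

  The archimedean block requires an identity between a spectral integral and an integral in \<open>y\<close>. Let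
  \<open>G\<close> be the folded correlation; it is smooth on \<open>[0, L]\<close> with \<open>G L = 0\<close>. The entry for finite \<open>T\<close> is
  \<open>1 / (2 \<pi>)\<close> times the integral over \<open>[-T, T]\<close> of \<open>h_plus\<close> times the cosine transform of \<open>G\<close>. Because
  \<open>G\<close> vanishes at \<open>L\<close>, the transform is \<open>O(1 / (1 + r\<^sup>2))\<close>, so everything converges absolutely and
  the limit \<open>T \<rightarrow> \<infinity>\<close> is the integral over the line. To evaluate it, expand the digamma function:
  \<open>h_plus r + \<gamma> + ln \<pi>\<close> is the sum over \<open>k\<close> of \<open>1 / (k + 1) - 2 a / (a\<^sup>2 + r\<^sup>2)\<close> with \<open>a = 2 k + 1/2\<close>.
  Fourier inversion at \<open>0\<close> handles the constants, and writing the Cauchy kernel as a Laplace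
  transform of cosines turns the remaining terms into the moments \<open>\<integral> G y exp (- a y) dy\<close>
  (\<open>h_plus_transform\<close>). On the other side, the kernel \<open>exp (y / 2) / (exp y - exp (- y))\<close> is the geometric series
  of exactly the same exponentials \<open>exp (- a y)\<close> (\<open>weil_kernel_integral\<close>). The moments cancel, and the
  constants that are left form the alternating harmonic series, whose value \<open>ln 2\<close> accounts for the
  difference between \<open>ln \<pi>\<close> and \<open>ln (4 \<pi>)\<close> (\<open>archimedean_explicit_formula\<close>).

  The statement for trigonometric polynomials follows from the one for basis functions because
  the coefficients are real, so that the correlation is a bilinear combination of the basis
  correlations with the coefficients of the quadratic form.
\<close>

section \<open>The cosine transform of a function vanishing at the end of its interval\<close>

lemma tendsto_LBINT_symmetric:
  fixes f :: "real \<Rightarrow> real"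
  assumes "integrable lborel f"
  shows "((\<lambda>T. LBINT r:{-T..T}. f r) \<longlongrightarrow> (LBINT r. f r)) at_top"
  unfolding set_lebesgue_integral_def
proof (rule integral_dominated_convergence_at_top[where w = "\<lambda>r. \<bar>f r\<bar>"])
  show "AE r in lborel. ((\<lambda>T. indicat_real {-T..T} r *\<^sub>R f r) \<longlongrightarrow> f r) at_top"
  proof (intro AE_I2 tendsto_eventually)
    fix r show "\<forall>\<^sub>F T in at_top. indicat_real {-T..T} r *\<^sub>R f r = f r"
      using eventually_ge_at_top[of "\<bar>r\<bar>"] by eventually_elim (auto simp: indicator_def)
  qed
qed (use assms in \<open>auto intro!: always_eventually simp: indicator_def\<close>)

lemma integrable_inverse_1_plus_square_lborel: "integrable lborel (\<lambda>x::real. 1 / (1 + x\<^sup>2))"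
  using integrable_inverse_1_plus_square
  by (simp add: set_integrable_def inverse_eq_divide)

lemma continuous_on_Si: "continuous_on A f \<Longrightarrow> continuous_on A (\<lambda>y. Si (f y))"
  by (rule continuous_on_compose2[of UNIV Si]) (auto simp: isCont_Si continuous_at_imp_continuous_on)

lemma integral_cos_symmetric:
  assumes "T \<ge> 0"
  shows "integral {-T..T} (\<lambda>r. cos (r * u)) = 2 * T * sinc (T * u)"
proof (cases "u = 0")
  case True
  then show ?thesis using assms by simp
next
  case False
  have "((\<lambda>r. cos (r * u)) has_integral (sin (T * u) / u - sin (- T * u) / u)) {-T..T}"
    using assms False
    by (intro fundamental_theorem_of_calculus)
       (auto intro!: derivative_eq_intros simp: has_real_derivative_iff_has_vector_derivative[symmetric])
  then show ?thesis using False by (auto simp: integral_unique)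
qed

text \<open>The Laplace transform turns a pole of \<open>h_plus\<close> into an average of cosines, to which Fourier
  inversion applies; the same formula with \<open>r = 0\<close> gives the exponential integrals.\<close>

lemma laplace_cos:
  fixes a r :: real
  assumes "a > 0"
  shows "set_integrable lborel {0<..} (\<lambda>s. cos (r * s) * exp (- (a * s)))"
    and "(LBINT s:{0<..}. cos (r * s) * exp (- (a * s))) = a / (a\<^sup>2 + r\<^sup>2)"
proof -
  show int: "set_integrable lborel {0<..} (\<lambda>s. cos (r * s) * exp (- (a * s)))"
    unfolding set_integrable_def
  proof (rule Bochner_Integration.integrable_bound)
    show "integrable lborel (\<lambda>s. indicat_real {0<..} s *\<^sub>R exp (- (s * a)))"
      using integrable_I0i_exp_mscale[OF assms] by (simp add: set_integrable_def)
    show "AE s in lborel. norm (indicat_real {0<..} s *\<^sub>R (cos (r * s) * exp (- (a * s))))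
        \<le> norm (indicat_real {0<..} s *\<^sub>R exp (- (s * a)))"
      by (auto simp: indicator_def abs_mult mult.commute mult_left_le_one_le)
  qed simp
  let ?F = "\<lambda>s. exp (- (a * s)) * (r * sin (r * s) - a * cos (r * s)) / (a\<^sup>2 + r\<^sup>2)"
  have pos: "a\<^sup>2 + r\<^sup>2 > 0" using assms by (simp add: add_pos_nonneg)
  have "(LBINT s=0..\<infinity>. cos (r * s) * exp (- (a * s))) = 0 - (- a / (a\<^sup>2 + r\<^sup>2))"
  proof (rule interval_integral_FTC_integrable[where F = ?F])
    fix s :: real
    have "((\<lambda>s. exp (- (a * s)) * (r * sin (r * s) - a * cos (r * s))) has_real_derivative
        cos (r * s) * exp (- (a * s)) * (a\<^sup>2 + r\<^sup>2)) (at s)"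
      by (auto intro!: derivative_eq_intros simp: algebra_simps power2_eq_square)
    from DERIV_cdivide[OF this, of "a\<^sup>2 + r\<^sup>2"]
    show "(?F has_vector_derivative cos (r * s) * exp (- (a * s))) (at s)"
      unfolding has_real_derivative_iff_has_vector_derivative[symmetric] using assms pos by simp
  next
    have "((\<lambda>s. ?F s) \<longlongrightarrow> ?F 0) (at_right 0)"
      using pos by (intro tendsto_intros) auto
    then show "((?F \<circ> real_of_ereal) \<longlongrightarrow> - a / (a\<^sup>2 + r\<^sup>2)) (at_right 0)"
      by (simp add: zero_ereal_def ereal_tendsto_simps1)
  next
    have "(?F \<longlongrightarrow> 0) at_top"
    proof (rule Lim_null_comparison)
      show "\<forall>\<^sub>F s in at_top. norm (?F s) \<le> exp (- (a * s)) * ((\<bar>r\<bar> + a) / (a\<^sup>2 + r\<^sup>2))"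
      proof (intro always_eventually allI)
        fix s
        have "\<bar>r * sin (r * s) - a * cos (r * s)\<bar> \<le> \<bar>r * sin (r * s)\<bar> + \<bar>a * cos (r * s)\<bar>"
          by linarith
        also have "\<dots> \<le> \<bar>r\<bar> * 1 + a * 1"
          using assms by (intro add_mono) (auto simp: abs_mult intro!: mult_left_le)
        finally show "norm (?F s) \<le> exp (- (a * s)) * ((\<bar>r\<bar> + a) / (a\<^sup>2 + r\<^sup>2))"
          using pos by (simp add: abs_mult divide_right_mono mult_left_mono)
      qed
      have "filterlim (\<lambda>s. a * s) at_top at_top"
        using assms by (intro filterlim_tendsto_pos_mult_at_top[OF tendsto_const] filterlim_ident)
      then have "((\<lambda>s. exp (- (a * s))) \<longlongrightarrow> 0) at_top"
        by (intro filterlim_compose[OF exp_at_bot] filterlim_uminus_at_bot_at_top filterlim_compose[OF filterlim_uminus_at_bot_at_top])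
      then show "((\<lambda>s. exp (- (a * s)) * ((\<bar>r\<bar> + a) / (a\<^sup>2 + r\<^sup>2))) \<longlongrightarrow> 0) at_top"
        by (rule tendsto_mult_left_zero)
    qed
    then show "((?F \<circ> real_of_ereal) \<longlongrightarrow> 0) (at_left \<infinity>)"
      by (simp add: ereal_tendsto_simps1)
  next
    show "set_integrable lborel (einterval 0 \<infinity>) (\<lambda>s. cos (r * s) * exp (- (a * s)))"
      using int by (simp add: zero_ereal_def)
  qed (auto intro!: continuous_intros)
  then show "(LBINT s:{0<..}. cos (r * s) * exp (- (a * s))) = a / (a\<^sup>2 + r\<^sup>2)"
    by (simp add: interval_lebesgue_integral_0_infty)
qed

text \<open>The setting of the archimedean computation. Cutting \<open>G\<close> off at \<open>L\<close> keeps it continuous because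
  \<open>G L = 0\<close>, and so does extending it evenly across \<open>0\<close>; the transform below is half the Fourier
  transform of the resulting compactly supported function. Derivatives are taken on the whole line to
  avoid one-sided derivatives at the endpoints.\<close>

locale vanishing_at_endpoint =
  fixes G G' G'' :: "real \<Rightarrow> real" and L :: real
  assumes L_pos: "L > 0"
    and G_deriv: "\<And>y. (G has_real_derivative G' y) (at y)"
    and G'_deriv: "\<And>y. (G' has_real_derivative G'' y) (at y)"
    and G''_cont: "continuous_on UNIV G''"
    and G_end: "G L = 0"
begin

lemma G'_cont: "continuous_on UNIV G'"
  using G'_deriv DERIV_isCont continuous_at_imp_continuous_on by blast

lemma G_cont: "continuous_on UNIV G"
  using G_deriv DERIV_isCont continuous_at_imp_continuous_on by blast

lemma cont_intros [continuous_intros]: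
  "continuous_on A f \<Longrightarrow> continuous_on A (\<lambda>x. G (f x))"
  "continuous_on A f \<Longrightarrow> continuous_on A (\<lambda>x. G' (f x))"
  "continuous_on A f \<Longrightarrow> continuous_on A (\<lambda>x. G'' (f x))"
  by (auto intro: continuous_on_compose2[OF G_cont] continuous_on_compose2[OF G'_cont]
      continuous_on_compose2[OF G''_cont])

lemma G_measurable [measurable]: "G \<in> borel_measurable borel"
  by (intro borel_measurable_continuous_onI G_cont)

text \<open>This represents the cut-off function only at arguments \<open>s \<ge> 0\<close>; no cut is made on the negative axis.\<close>

definition trunc :: "real \<Rightarrow> real" where
  "trunc s = (if s \<le> L then G s else 0)"

lemma trunc_measurable [measurable]: "trunc \<in> borel_measurable borel"
  unfolding trunc_def by measurable

definition cos_transform :: "real \<Rightarrow> real" where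
  "cos_transform r = integral {0..L} (\<lambda>y. G y * cos (r * y))"

lemma cos_transform_cont: "continuous_on A cos_transform"
proof -
  have "continuous_on UNIV (\<lambda>r. integral (cbox 0 L) (\<lambda>y. G y * cos (r * y)))"
    by (rule integral_continuous_on_param) (auto intro!: continuous_intros simp: split_def)
  then show ?thesis
    unfolding cos_transform_def by (auto intro: continuous_on_subset)
qed

lemma cos_transform_cont_intros [continuous_intros]:
  "continuous_on A f \<Longrightarrow> continuous_on A (\<lambda>x. cos_transform (f x))"
  by (auto intro: continuous_on_compose2[OF cos_transform_cont])

lemma cos_transform_measurable [measurable]: "cos_transform \<in> borel_measurable borel"
  by (intro borel_measurable_continuous_onI cos_transform_cont)

text \<open>Two integrations by parts: the first boundary term disappears because \<open>G L = 0\<close> and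
  \<open>sin 0 = 0\<close>, so only terms of size \<open>1 / r\<^sup>2\<close> remain. Working with \<open>(1 + r\<^sup>2)\<close> times the transform
  avoids dividing by \<open>r\<close> and covers \<open>r = 0\<close> as well.\<close>

lemma cos_transform_decay: "\<exists>K\<ge>0. \<forall>r. \<bar>cos_transform r\<bar> \<le> K / (1 + r\<^sup>2)"
proof -
  define M where "M = integral {0..L} (\<lambda>y. \<bar>G y - G'' y\<bar>)"
  define K where "K = \<bar>G' L\<bar> + \<bar>G' 0\<bar> + M"
  have M: "M \<ge> 0" unfolding M_def
    by (intro integral_nonneg integrable_continuous_interval continuous_intros) auto
  have "\<bar>cos_transform r\<bar> \<le> K / (1 + r\<^sup>2)" for r
  proof -
    \<comment> \<open>The antiderivative \<open>r G(y) sin(ry) + G'(y) cos(ry)\<close> performs both integrations by parts at once.\<close>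
    have "((\<lambda>y. r\<^sup>2 * (G y * cos (r * y)) + G'' y * cos (r * y)) has_integral
        ((r * G L * sin (r * L) + G' L * cos (r * L)) - (r * G 0 * sin (r * 0) + G' 0 * cos (r * 0)))) {0..L}"
      using L_pos
      by (intro fundamental_theorem_of_calculus)
         (auto intro!: derivative_eq_intros DERIV_subset[OF G_deriv] DERIV_subset[OF G'_deriv]
           simp: has_real_derivative_iff_has_vector_derivative[symmetric] algebra_simps power2_eq_square)
    then have 1: "((\<lambda>y. r\<^sup>2 * (G y * cos (r * y)) + G'' y * cos (r * y)) has_integral
        (G' L * cos (r * L) - G' 0)) {0..L}" by (simp add: G_end)
    have 2: "((\<lambda>y. G y * cos (r * y)) has_integral cos_transform r) {0..L}"
      unfolding cos_transform_def
      by (intro integrable_integral integrable_continuous_interval continuous_intros)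
    have 3: "((\<lambda>y. (G y - G'' y) * cos (r * y)) has_integral
         integral {0..L} (\<lambda>y. (G y - G'' y) * cos (r * y))) {0..L}"
      by (intro integrable_integral integrable_continuous_interval continuous_intros)
    have "((\<lambda>y. (1 + r\<^sup>2) * (G y * cos (r * y))) has_integral
       (G' L * cos (r * L) - G' 0 + integral {0..L} (\<lambda>y. (G y - G'' y) * cos (r * y)))) {0..L}"
      using has_integral_add[OF 1 3] by (simp add: algebra_simps)
    from has_integral_unique[OF this has_integral_mult_right[OF 2]]
    have "(1 + r\<^sup>2) * cos_transform r
      = G' L * cos (r * L) - G' 0 + integral {0..L} (\<lambda>y. (G y - G'' y) * cos (r * y))" by simp
    moreover have "\<bar>integral {0..L} (\<lambda>y. (G y - G'' y) * cos (r * y))\<bar> \<le> M"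
      unfolding M_def real_norm_def[symmetric]
      by (intro integral_norm_bound_integral integrable_continuous_interval continuous_intros)
         (auto simp: abs_mult intro!: mult_left_le)
    moreover have "\<bar>G' L * cos (r * L)\<bar> \<le> \<bar>G' L\<bar>"
      by (auto simp: abs_mult intro!: mult_left_le)
    ultimately have "\<bar>(1 + r\<^sup>2) * cos_transform r\<bar> \<le> K" unfolding K_def by linarith
    moreover have "1 + r\<^sup>2 > 0" by (simp add: add_pos_nonneg)
    ultimately show ?thesis by (simp add: abs_mult field_simps)
  qed
  moreover have "K \<ge> 0" using M by (simp add: K_def)
  ultimately show ?thesis by blast
qed

lemma integrable_cos_transform_mult:
  assumes [measurable]: "f \<in> borel_measurable borel" and "\<And>r. \<bar>f r\<bar> \<le> B"
  shows "integrable lborel (\<lambda>r. cos_transform r * f r)"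
proof -
  obtain K where K: "K \<ge> 0" "\<And>r. \<bar>cos_transform r\<bar> \<le> K / (1 + r\<^sup>2)"
    using cos_transform_decay by blast
  show ?thesis
  proof (rule Bochner_Integration.integrable_bound)
    show "integrable lborel (\<lambda>r. K * B * (1 / (1 + r\<^sup>2)))"
      by (intro integrable_mult_right integrable_inverse_1_plus_square_lborel)
    show "AE r in lborel. norm (cos_transform r * f r) \<le> norm (K * B * (1 / (1 + r\<^sup>2)))"
    proof (intro AE_I2)
      fix r
      have "B \<ge> 0" using assms(2)[of 0] by linarith
      have "\<bar>cos_transform r\<bar> * \<bar>f r\<bar> \<le> K / (1 + r\<^sup>2) * B"
        using K assms(2) by (intro mult_mono) (auto intro!: divide_nonneg_nonneg)
      then show "norm (cos_transform r * f r) \<le> norm (K * B * (1 / (1 + r\<^sup>2)))"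
        using \<open>B \<ge> 0\<close> K(1) by (simp add: abs_mult mult_ac)
    qed
  qed simp
qed

text \<open>Exchanging the integrals produces Dirichlet kernels, whose primitive in \<open>y\<close> is the sine integral.
  Integrating by parts leaves no boundary terms: \<open>G\<close> vanishes at \<open>L\<close>, and at \<open>0\<close> the two sine
  integrals cancel because \<open>Si\<close> is odd. What remains involves the bounded function \<open>Si\<close> instead
  of a kernel that concentrates.\<close>

lemma integral_cos_transform_symmetric:
  assumes "s \<ge> 0" "T > 0"
  shows "(LBINT r:{-T..T}. cos_transform r * cos (r * s))
    = - integral {0..L} (\<lambda>y. G' y * (Si (T * (y + s)) + Si (T * (y - s))))"
proof -
  have "(LBINT r:{-T..T}. cos_transform r * cos (r * s)) = integral {-T..T} (\<lambda>r. cos_transform r * cos (r * s))"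
    by (intro set_borel_integral_eq_integral borel_integrable_atLeastAtMost' continuous_intros)
  also have "\<dots> = integral {-T..T} (\<lambda>r. integral {0..L} (\<lambda>y. G y * cos (r * y) * cos (r * s)))"
    unfolding cos_transform_def by simp
  also have "\<dots> = integral {0..L} (\<lambda>y. integral {-T..T} (\<lambda>r. G y * cos (r * y) * cos (r * s)))"
    unfolding box_real(2)[symmetric]
    by (rule integral_swap_continuous) (auto intro!: continuous_intros simp: split_def)
  also have "\<dots> = integral {0..L} (\<lambda>y. G y * (T * sinc (T * (y + s)) + T * sinc (T * (y - s))))"
  proof (rule Henstock_Kurzweil_Integration.integral_cong)
    fix y
    have "integral {-T..T} (\<lambda>r. G y * cos (r * y) * cos (r * s))
       = integral {-T..T} (\<lambda>r. G y / 2 * (cos (r * (y + s)) + cos (r * (y - s))))"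
      by (intro Henstock_Kurzweil_Integration.integral_cong)
         (simp add: cos_add cos_diff algebra_simps)
    also have "\<dots> = G y / 2 * (integral {-T..T} (\<lambda>r. cos (r * (y + s))) + integral {-T..T} (\<lambda>r. cos (r * (y - s))))"
      by (subst Henstock_Kurzweil_Integration.integral_add[symmetric])
         (auto intro!: integrable_continuous_interval continuous_intros)
    also have "\<dots> = G y * (T * sinc (T * (y + s)) + T * sinc (T * (y - s)))"
      using assms(2) by (subst (1 2) integral_cos_symmetric) (auto simp: algebra_simps)
    finally show "integral {-T..T} (\<lambda>r. G y * cos (r * y) * cos (r * s))
       = G y * (T * sinc (T * (y + s)) + T * sinc (T * (y - s)))" .
  qed
  also have "\<dots> = - integral {0..L} (\<lambda>y. G' y * (Si (T * (y + s)) + Si (T * (y - s))))"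
  proof -
    let ?\<Theta> = "\<lambda>y. Si (T * (y + s)) + Si (T * (y - s))"
    have \<Theta>: "(?\<Theta> has_real_derivative (T * sinc (T * (y + s)) + T * sinc (T * (y - s)))) (at y within A)" for y A
      by (rule derivative_eq_intros DERIV_chain2[OF DERIV_Si] refl | simp)+
    have \<Theta>0: "?\<Theta> 0 = 0" using Si_neg[of "T * s"] assms by simp
    have "((\<lambda>y. G' y * ?\<Theta> y + G y * (T * sinc (T * (y + s)) + T * sinc (T * (y - s)))) has_integral
        G L * ?\<Theta> L - G 0 * ?\<Theta> 0) {0..L}"
    proof (rule fundamental_theorem_of_calculus)
      show "((\<lambda>y. G y * ?\<Theta> y) has_vector_derivative
          G' y * ?\<Theta> y + G y * (T * sinc (T * (y + s)) + T * sinc (T * (y - s)))) (at y within {0..L})" for y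
        unfolding has_real_derivative_iff_has_vector_derivative[symmetric]
        by (subst add.commute) (rule DERIV_mult'[OF DERIV_subset[OF G_deriv subset_UNIV] \<Theta>])
    qed (use L_pos in simp)
    then have part: "((\<lambda>y. G' y * ?\<Theta> y + G y * (T * sinc (T * (y + s)) + T * sinc (T * (y - s)))) has_integral 0) {0..L}"
      by (simp only: G_end \<Theta>0 mult_zero_left mult_zero_right diff_self)
    have i1: "(\<lambda>y. G' y * ?\<Theta> y) integrable_on {0..L}"
      by (intro integrable_continuous_interval continuous_intros continuous_on_Si)
    have i2: "(\<lambda>y. G y * (T * sinc (T * (y + s)) + T * sinc (T * (y - s)))) integrable_on {0..L}"
      by (intro integrable_continuous_interval continuous_intros)
    from has_integral_unique[OF has_integral_add[OF integrable_integral[OF i1] integrable_integral[OF i2]] part]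
    show ?thesis by linarith
  qed
  finally show ?thesis .
qed


text \<open>Fourier inversion. As \<open>T\<close> grows, \<open>Si (T * (y + s)) + Si (T * (y - s))\<close> stays bounded and tends to
  \<open>\<pi>\<close> for \<open>y > s\<close> and to \<open>0\<close> for \<open>y < s\<close>, so the previous lemma converges to
  \<open>-\<pi>\<close> times the integral of \<open>G'\<close> over the part of \<open>[0, L]\<close> beyond \<open>s\<close>.\<close>

lemma cos_transform_inversion:
  assumes "s \<ge> 0"
  shows "(LBINT r. cos_transform r * cos (r * s)) = pi * trunc s"
proof (rule tendsto_unique)
  show "((\<lambda>T. LBINT r:{-T..T}. cos_transform r * cos (r * s)) \<longlongrightarrow> (LBINT r. cos_transform r * cos (r * s))) at_top"
    by (intro tendsto_LBINT_symmetric integrable_cos_transform_mult[where B = 1]) auto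
  obtain B where B: "\<And>T. \<bar>Si T\<bar> \<le> B" using bounded_Si by blast
  let ?f = "\<lambda>y. if s < y then pi * G' y else 0"
  have [measurable]: "G' \<in> borel_measurable borel"
    by (intro borel_measurable_continuous_onI G'_cont)
  \<comment> \<open>Almost every \<open>y\<close> makes \<open>y + s\<close> positive and \<open>y - s\<close> nonzero, so both sine integrals converge.\<close>
  have "((\<lambda>T. LBINT y:{0..L}. G' y * (Si (T * (y + s)) + Si (T * (y - s)))) \<longlongrightarrow> (LBINT y:{0..L}. ?f y)) at_top"
    unfolding set_lebesgue_integral_def
  proof (rule integral_dominated_convergence_at_top[where w = "\<lambda>y. indicator {0..L} y *\<^sub>R (\<bar>G' y\<bar> * (B + B))"])
    show "AE y in lborel. ((\<lambda>T. indicat_real {0..L} y *\<^sub>R (G' y * (Si (T * (y + s)) + Si (T * (y - s)))))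
        \<longlongrightarrow> indicat_real {0..L} y *\<^sub>R ?f y) at_top"
      using AE_lborel_singleton[of s] AE_lborel_singleton[of 0]
    proof eventually_elim
      case (elim y)
      show ?case
      proof (cases "y \<in> {0..L}")
        case True
        have top: "filterlim (\<lambda>T::real. T * u) at_top at_top" if "u > 0" for u
          using filterlim_tendsto_pos_mult_at_top[OF tendsto_const that filterlim_ident] by (simp add: mult.commute)
        have pos: "((\<lambda>T. Si (T * u)) \<longlongrightarrow> pi / 2) at_top" if "u > 0" for u
          using filterlim_compose[OF Si_at_top top[OF that]] .
        have neg: "((\<lambda>T. Si (T * u)) \<longlongrightarrow> - (pi / 2)) at_top" if "u < 0" for u
        proof (rule Lim_transform_eventually[OF tendsto_minus[OF pos[of "- u"]]])
          show "\<forall>\<^sub>F T in at_top. - Si (T * - u) = Si (T * u)"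
            using eventually_ge_at_top[of 0]
          proof eventually_elim
            case (elim T)
            with that have "T * - u \<ge> 0" by (simp add: mult_nonneg_nonpos)
            from Si_neg[OF this] show ?case by simp
          qed
        qed (use that in auto)
        have 1: "((\<lambda>T. Si (T * (y + s))) \<longlongrightarrow> pi / 2) at_top"
          using True elim assms by (intro pos) auto
        have 2: "((\<lambda>T. Si (T * (y - s))) \<longlongrightarrow> (if s < y then pi / 2 else - (pi / 2))) at_top"
          using elim by (auto intro: pos neg)
        show ?thesis
          by (rule tendsto_eq_intros 1 2 refl | simp)+
      qed auto
    qed
    show "integrable lborel (\<lambda>y. indicat_real {0..L} y *\<^sub>R (\<bar>G' y\<bar> * (B + B)))"
      by (intro borel_integrable_compact continuous_intros) auto
    show "\<forall>\<^sub>F T in at_top. AE y in lborel.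
        norm (indicat_real {0..L} y *\<^sub>R (G' y * (Si (T * (y + s)) + Si (T * (y - s)))))
          \<le> indicat_real {0..L} y *\<^sub>R (\<bar>G' y\<bar> * (B + B))"
    proof (intro always_eventually allI AE_I2)
      fix T y
      have "\<bar>Si (T * (y + s)) + Si (T * (y - s))\<bar> \<le> B + B"
        using B[of "T * (y + s)"] B[of "T * (y - s)"] by linarith
      then show "norm (indicat_real {0..L} y *\<^sub>R (G' y * (Si (T * (y + s)) + Si (T * (y - s)))))
          \<le> indicat_real {0..L} y *\<^sub>R (\<bar>G' y\<bar> * (B + B))"
        by (auto simp: abs_mult indicator_def mult_left_mono)
    qed
  qed measurable
  moreover have "(LBINT y:{0..L}. G' y * (Si (T * (y + s)) + Si (T * (y - s))))
     = integral {0..L} (\<lambda>y. G' y * (Si (T * (y + s)) + Si (T * (y - s))))" for T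
    by (intro set_borel_integral_eq_integral borel_integrable_atLeastAtMost' continuous_intros continuous_on_Si)
  moreover have "(LBINT y:{0..L}. ?f y) = - pi * trunc s"
  proof (cases "s \<le> L")
    case True
    have "(LBINT y:{0..L}. ?f y) = (LBINT y. indicator {s..L} y *\<^sub>R (pi * G' y))"
      unfolding set_lebesgue_integral_def
      by (rule integral_cong_AE) (use AE_lborel_singleton[of s] assms in \<open>auto simp: indicator_def elim!: eventually_mono\<close>)
    also have "\<dots> = pi * G L - pi * G s"
      using True
      by (intro integral_FTC_atLeastAtMost)
         (auto intro!: derivative_eq_intros DERIV_subset[OF G_deriv] continuous_intros
           simp: has_real_derivative_iff_has_vector_derivative[symmetric])
    finally show ?thesis using True by (simp add: G_end trunc_def)
  next
    case False
    have "(LBINT y:{0..L}. ?f y) = (LBINT y:{0..L}. 0)"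
      by (rule set_lebesgue_integral_cong) (use False in auto)
    then show ?thesis using False by (simp add: trunc_def)
  qed
  ultimately have *: "((\<lambda>T. - integral {0..L} (\<lambda>y. G' y * (Si (T * (y + s)) + Si (T * (y - s))))) \<longlongrightarrow> pi * trunc s) at_top"
    by (auto intro: tendsto_eq_intros)
  show "((\<lambda>T. LBINT r:{-T..T}. cos_transform r * cos (r * s)) \<longlongrightarrow> pi * trunc s) at_top"
    by (rule Lim_transform_eventually[OF *])
       (use eventually_gt_at_top[of 0] in eventually_elim, use integral_cos_transform_symmetric assms in simp)
qed simp

text \<open>The kernel \<open>a / (a\<^sup>2 + r\<^sup>2)\<close> is the average of \<open>cos (r * s)\<close> against \<open>exp (- a * s)\<close>, and
  integrability of the transform allows inversion under that average.\<close>

lemma integral_cos_transform_cauchy: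
  assumes "a > 0"
  shows "(LBINT r. cos_transform r * (a / (a\<^sup>2 + r\<^sup>2))) = pi * (LBINT y:{0..L}. G y * exp (- (a * y)))"
proof -
  let ?f = "\<lambda>r s. cos_transform r * (indicator {0<..} s *\<^sub>R (cos (r * s) * exp (- (a * s))))"
  have e: "integrable lborel (\<lambda>s. indicat_real {0<..} s *\<^sub>R exp (- (a * s)))"
    using laplace_cos(1)[OF assms, of 0] by (simp add: set_integrable_def)
  have integ: "integrable (lborel \<Otimes>\<^sub>M lborel) (case_prod ?f)"
  proof (rule Bochner_Integration.integrable_bound)
    show "integrable (lborel \<Otimes>\<^sub>M lborel) (\<lambda>(r, s). (cos_transform r * 1) * (indicat_real {0<..} s *\<^sub>R exp (- (a * s))))"
    proof (rule lborel_pair.Fubini_integrable)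
      show "integrable lborel (\<lambda>r. LBINT s. norm (case (r, s) of (r, s) \<Rightarrow> (cos_transform r * 1) * (indicat_real {0<..} s *\<^sub>R exp (- (a * s)))))"
        using integrable_cos_transform_mult[of "\<lambda>_. 1" 1, THEN integrable_abs]
        by (simp add: abs_mult)
      show "AE r in lborel. integrable lborel (\<lambda>s. case (r, s) of (r, s) \<Rightarrow> (cos_transform r * 1) * (indicat_real {0<..} s *\<^sub>R exp (- (a * s))))"
        using e by simp
    qed (simp add: split_def)
    show "AE p in lborel \<Otimes>\<^sub>M lborel. norm (case_prod ?f p)
        \<le> norm (case p of (r, s) \<Rightarrow> (cos_transform r * 1) * (indicat_real {0<..} s *\<^sub>R exp (- (a * s))))"
      by (intro AE_I2) (auto simp: abs_mult indicator_def mult_left_le_one_le mult_left_mono)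
  qed (simp add: split_def)
  have "(LBINT r. cos_transform r * (a / (a\<^sup>2 + r\<^sup>2))) = (LBINT r. LBINT s. ?f r s)"
    using laplace_cos(2)[OF assms] by (simp add: set_lebesgue_integral_def)
  also have "\<dots> = (LBINT s. LBINT r. ?f r s)"
    by (rule lborel_pair.Fubini_integral[OF integ, symmetric])
  also have "\<dots> = (LBINT s. pi * (indicator {0..L} s *\<^sub>R (G s * exp (- (a * s)))))"
  proof (rule integral_cong_AE)
    show "AE s in lborel. (LBINT r. ?f r s) = pi * (indicator {0..L} s *\<^sub>R (G s * exp (- (a * s))))"
      using AE_lborel_singleton[of 0]
    proof eventually_elim
      case (elim s)
      have "(LBINT r. ?f r s) = (LBINT r. (cos_transform r * cos (r * s)) * (indicator {0<..} s * exp (- (a * s))))"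
        by (intro Bochner_Integration.integral_cong) (auto simp: mult_ac)
      also have "\<dots> = (LBINT r. cos_transform r * cos (r * s)) * (indicator {0<..} s * exp (- (a * s)))"
        by (rule integral_mult_left_zero)
      also have "\<dots> = pi * (indicator {0..L} s *\<^sub>R (G s * exp (- (a * s))))"
        using elim cos_transform_inversion[of s] by (auto simp: indicator_def trunc_def)
      finally show ?case .
    qed
  qed measurable
  finally show ?thesis by (simp add: set_lebesgue_integral_def)
qed

lemma integral_cos_transform: "(LBINT r. cos_transform r) = pi * G 0"
  using cos_transform_inversion[of 0] L_pos by (simp add: trunc_def)

end

section \<open>The archimedean explicit formula\<close>

text \<open>The function \<open>h_plus\<close> continues meromorphically with simple poles at \<open>\<plusminus>i (2 k + 1/2)\<close>.\<close>

definition pole_height :: "nat \<Rightarrow> real" where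
  "pole_height k = 2 * real k + 1 / 2"

lemma pole_height_ge: "pole_height k \<ge> (real k + 1) / 2"
  by (simp add: pole_height_def)

lemma pole_height_pos [simp]: "pole_height k > 0"
  by (simp add: pole_height_def add_nonneg_pos)

definition h_term :: "nat \<Rightarrow> real \<Rightarrow> real" where
  "h_term k r = 1 / (real k + 1) - 2 * (pole_height k / ((pole_height k)\<^sup>2 + r\<^sup>2))"

text \<open>The partial fraction series of the digamma function at \<open>1/4 + i r/2\<close>.\<close>

lemma h_plus_sums: "(\<lambda>k. h_term k r) sums (h_plus r + euler_mascheroni + ln pi)"
proof -
  have Re_em: "Re euler_mascheroni = euler_mascheroni"
    by (subst of_real_euler_mascheroni[symmetric]) (rule Re_complex_of_real)
  define z where "z = 1 / 4 + \<i> * complex_of_real r / 2"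
  have "Re z = 1 / 4" by (simp add: z_def)
  then have "z \<noteq> 0" by auto
  from summable_sums[OF summable_Digamma[OF this]]
  have "(\<lambda>k. inverse (of_nat (Suc k)) - inverse (z + of_nat k)) sums (Digamma z + euler_mascheroni)"
    by (simp add: Digamma_def)
  from sums_Re[OF this]
  have "(\<lambda>k. Re (inverse (of_nat (Suc k)) - inverse (z + of_nat k))) sums (h_plus r + euler_mascheroni + ln pi)"
    by (simp add: h_plus_def z_def Re_em)
  moreover have "Re (inverse (of_nat (Suc k)) - inverse (z + of_nat k)) = h_term k r" for k
  proof -
    have "Re (inverse (of_nat (Suc k) :: complex)) = 1 / (real k + 1)"
      by (simp add: inverse_eq_divide Re_divide_of_nat add.commute del: of_nat_Suc)
    moreover have "Re (inverse (z + of_nat k)) = (pole_height k / 2) / ((pole_height k / 2)\<^sup>2 + (r / 2)\<^sup>2)"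
      by (simp add: z_def pole_height_def add_divide_distrib add.commute)
    moreover have "\<dots> = 2 * (pole_height k / ((pole_height k)\<^sup>2 + r\<^sup>2))"
      by (simp add: power_divide add_divide_distrib[symmetric])
    ultimately show ?thesis by (simp add: h_term_def)
  qed
  ultimately show ?thesis by simp
qed

text \<open>The right-hand side is arranged so that, after integration against \<open>1 / (1 + r\<^sup>2)\<close>, both parts are
  of order \<open>1 / k\<^sup>2\<close>: for the first part \<open>r\<^sup>2 / (1 + r\<^sup>2) \<le> 1\<close> leaves \<open>1 / (a\<^sup>2 + r\<^sup>2)\<close>, whose
  integral is \<open>\<pi> / a\<close>. A bound uniform in \<open>r\<close> would only be of order \<open>1 / k\<close>.\<close>

lemma h_term_bound:
  "\<bar>h_term k r\<bar> \<le> (r\<^sup>2 / ((pole_height k)\<^sup>2 + r\<^sup>2) + 3 / (2 * pole_height k)) / (real k + 1)"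
proof -
  define a where "a = pole_height k"
  have a: "a > 0" "real k + 1 = (a + 3 / 2) / 2" by (simp_all add: a_def pole_height_def field_simps)
  have pos: "a\<^sup>2 + r\<^sup>2 > 0" using a by (simp add: add_pos_nonneg)
  have h: "h_term k r = (r\<^sup>2 / (a\<^sup>2 + r\<^sup>2) - 3 / 2 * (a / (a\<^sup>2 + r\<^sup>2))) / (real k + 1)"
    unfolding h_term_def a_def[symmetric] a(2) using a(1) pos
    by (simp add: divide_simps) (simp add: algebra_simps power2_eq_square)
  have le: "a / (a\<^sup>2 + r\<^sup>2) \<le> 1 / a" "a / (a\<^sup>2 + r\<^sup>2) \<ge> 0" "r\<^sup>2 / (a\<^sup>2 + r\<^sup>2) \<ge> 0"
    using a(1) pos by (auto simp: divide_simps power2_eq_square)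
  moreover have "\<bar>r\<^sup>2 / (a\<^sup>2 + r\<^sup>2) - 3 / 2 * (a / (a\<^sup>2 + r\<^sup>2))\<bar> \<le> r\<^sup>2 / (a\<^sup>2 + r\<^sup>2) + 3 / (2 * a)"
  proof -
    have "\<bar>p - 3 / 2 * u\<bar> \<le> p + 3 / 2 * q" if "u \<le> q" "u \<ge> 0" "p \<ge> 0" for p u q :: real
      using that by linarith
    from this[of "a / (a\<^sup>2 + r\<^sup>2)" "1 / a" "r\<^sup>2 / (a\<^sup>2 + r\<^sup>2)"] le show ?thesis by simp
  qed
  ultimately show ?thesis
    unfolding h a_def abs_divide by (simp add: divide_right_mono del: times_divide_eq_right)
qed

lemma cauchy_integral:
  fixes a :: real
  assumes "a > 0"
  shows "integrable lborel (\<lambda>r. 1 / (a\<^sup>2 + r\<^sup>2))" "(LBINT r. 1 / (a\<^sup>2 + r\<^sup>2)) = pi / a"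
proof -
  have "has_bochner_integral lborel (\<lambda>r. 1 / (1 + r\<^sup>2)) pi"
    using integrable_inverse_1_plus_square_lborel LBINT_inverse_1_plus_square
    by (simp add: has_bochner_integral_iff inverse_eq_divide interval_lebesgue_integral_def set_lebesgue_integral_def)
  then have "has_bochner_integral lborel (\<lambda>r. 1 / (1 + (0 + 1 / a * r)\<^sup>2)) (pi /\<^sub>R \<bar>1 / a\<bar>)"
    using assms by (subst (asm) lborel_has_bochner_integral_real_affine_iff[of "1 / a" _ _ 0]) auto
  from has_bochner_integral_mult_right[OF this, of "1 / a\<^sup>2"]
  have "has_bochner_integral lborel (\<lambda>r. 1 / (a\<^sup>2 + r\<^sup>2)) (pi / a)"
    using assms by (simp add: field_simps power2_eq_square)
  then show "integrable lborel (\<lambda>r. 1 / (a\<^sup>2 + r\<^sup>2))" "(LBINT r. 1 / (a\<^sup>2 + r\<^sup>2)) = pi / a"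
    by (simp_all add: has_bochner_integral_iff)
qed

lemma summable_pole_height: "summable (\<lambda>k. 1 / ((real k + 1) * pole_height k))"
    "summable (\<lambda>k. 1 / (pole_height k)\<^sup>2)"
proof -
  have s: "summable (\<lambda>k. 4 * inverse ((real (Suc k))\<^sup>2))"
    using inverse_power_summable[of 2, where 'a = real, THEN summable_ignore_initial_segment, of 1]
    by (intro summable_mult) auto
  have ge: "(real k + 1) / 2 \<le> pole_height k" for k by (rule pole_height_ge)
  show "summable (\<lambda>k. 1 / ((real k + 1) * pole_height k))"
  proof (rule summable_comparison_test'[OF s, of 0])
    fix k :: nat
    have "(real k + 1) * ((real k + 1) / 4) \<le> (real k + 1) * pole_height k"
      using ge[of k] by (intro mult_left_mono) auto
    then have "1 / ((real k + 1) * pole_height k) \<le> 1 / ((real k + 1) * ((real k + 1) / 4))"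
      by (intro divide_left_mono mult_pos_pos) auto
    then show "norm (1 / ((real k + 1) * pole_height k)) \<le> 4 * inverse ((real (Suc k))\<^sup>2)"
      by (simp add: abs_mult inverse_eq_divide power2_eq_square add.commute less_imp_le)
  qed
  show "summable (\<lambda>k. 1 / (pole_height k)\<^sup>2)"
  proof (rule summable_comparison_test'[OF s, of 0])
    fix k :: nat
    have "((real k + 1) / 2)\<^sup>2 \<le> (pole_height k)\<^sup>2"
      using ge[of k] by (intro power_mono) auto
    then have "1 / (pole_height k)\<^sup>2 \<le> 1 / ((real k + 1) / 2)\<^sup>2"
      by (intro divide_left_mono mult_pos_pos) auto
    then show "norm (1 / (pole_height k)\<^sup>2) \<le> 4 * inverse ((real (Suc k))\<^sup>2)"
      by (simp add: inverse_eq_divide power_divide add.commute)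
  qed
qed

lemma linear_exp_integral:
  fixes a :: real
  assumes "a > 0"
  shows "integrable lborel (\<lambda>y. indicator {0<..} y * (y * exp (- (a * y))))"
    and "(LBINT y. indicator {0<..} y * (y * exp (- (a * y)))) = 1 / a\<^sup>2"
proof -
  have "has_bochner_integral lborel (\<lambda>x. x * exp (- x) * indicator {0<..} x) (1 :: real)"
    using has_bochner_integral_I0i_power_exp_m[of 1] by simp
  then have "has_bochner_integral lborel
     (\<lambda>y. (0 + a * y) * exp (- (0 + a * y)) * indicator {0<..} (0 + a * y)) (1 /\<^sub>R \<bar>a\<bar> :: real)"
    using assms by (subst (asm) lborel_has_bochner_integral_real_affine_iff[of a _ _ 0]) auto
  from has_bochner_integral_mult_right[OF this, of "1 / a"]
  have "has_bochner_integral lborel (\<lambda>y. indicator {0<..} y * (y * exp (- (a * y)))) (1 / a\<^sup>2)"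
    using assms by (simp add: field_simps power2_eq_square indicator_def zero_less_mult_iff cong: if_cong)
  then show "integrable lborel (\<lambda>y. indicator {0<..} y * (y * exp (- (a * y))))"
    and "(LBINT y. indicator {0<..} y * (y * exp (- (a * y)))) = 1 / a\<^sup>2"
    by (simp_all add: has_bochner_integral_iff)
qed

text \<open>A geometric series with ratio \<open>exp (- 2 * y)\<close>: the exponents of the kernel of the archimedean
  functional are exactly the pole heights of \<open>h_plus\<close>, which is why both sides can be
  compared term by term.\<close>

lemma weil_kernel_sums:
  assumes "y > 0"
  shows "(\<lambda>k. exp (- (pole_height k * y))) sums (exp (y / 2) / (exp y - exp (- y)))"
proof -
  have "(\<lambda>k. exp (- (y / 2)) * exp (- (2 * y)) ^ k) sums (exp (- (y / 2)) * (1 / (1 - exp (- (2 * y)))))"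
    using assms by (intro sums_mult geometric_sums) simp
  moreover have "exp (- (y / 2)) * exp (- (2 * y)) ^ k = exp (- (pole_height k * y))" for k
    by (simp add: pole_height_def exp_of_nat_mult[symmetric] exp_add[symmetric] algebra_simps)
  moreover have "exp (- (y / 2)) * (1 / (1 - exp (- (2 * y)))) = exp (y / 2) / (exp y - exp (- y))"
  proof -
    have "exp (y / 2) = exp (- (y / 2)) * exp y" "exp (- y) = exp (- (2 * y)) * exp y"
      by (simp_all add: exp_add[symmetric])
    then have "exp (y / 2) / (exp y - exp (- y)) = (exp (- (y / 2)) * exp y) / ((1 - exp (- (2 * y))) * exp y)"
      by (simp add: algebra_simps)
    then show ?thesis by simp
  qed
  ultimately show ?thesis by simp
qed

context vanishing_at_endpoint
begin

definition laplace_trunc :: "real \<Rightarrow> real" where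
  "laplace_trunc a = (LBINT y:{0..L}. G y * exp (- (a * y)))"

text \<open>Integrating the partial fraction series term by term. Each term contributes \<open>G 0\<close> through
  inversion at \<open>0\<close> and an exponential moment of \<open>G\<close> through the Cauchy kernel; the exchange of sum
  and integral is absolute because the transform decays like \<open>1 / (1 + r\<^sup>2)\<close>.\<close>

lemma h_plus_transform:
  shows "integrable lborel (\<lambda>r. h_plus r * cos_transform r)"
    and "(\<lambda>k. pi * G 0 / (real k + 1) - 2 * pi * laplace_trunc (pole_height k)) sums
      ((LBINT r. h_plus r * cos_transform r) + (euler_mascheroni + ln pi) * (pi * G 0))"
proof -
  obtain K where K: "K \<ge> 0" "\<And>r. \<bar>cos_transform r\<bar> \<le> K / (1 + r\<^sup>2)"
    using cos_transform_decay by blast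
  let ?f = "\<lambda>k r. cos_transform r * h_term k r"
  have meas[measurable]: "h_term k \<in> borel_measurable borel" for k
    unfolding h_term_def by measurable
  have intC: "integrable lborel (\<lambda>r. cos_transform r * (pole_height k / ((pole_height k)\<^sup>2 + r\<^sup>2)))" for k
  proof (rule integrable_cos_transform_mult[where B = "1 / pole_height k"])
    fix r
    have "pole_height k > 0" by simp
    moreover from this have "(pole_height k)\<^sup>2 + r\<^sup>2 > 0" by (intro add_pos_nonneg zero_less_power) auto
    ultimately show "\<bar>pole_height k / ((pole_height k)\<^sup>2 + r\<^sup>2)\<bar> \<le> 1 / pole_height k"
      unfolding abs_divide abs_of_pos[OF pole_height_pos]
      by (simp add: abs_divide divide_simps power2_eq_square)
  qed measurable
  have int1: "integrable lborel cos_transform"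
    using integrable_cos_transform_mult[of "\<lambda>_. 1" 1] by simp
  have f_eq: "?f k = (\<lambda>r. cos_transform r * (1 / (real k + 1))
      - 2 * (cos_transform r * (pole_height k / ((pole_height k)\<^sup>2 + r\<^sup>2))))" for k
    by (simp add: h_term_def fun_eq_iff algebra_simps)
  have int: "integrable lborel (?f k)" for k
    unfolding f_eq using int1 intC
    by (intro Bochner_Integration.integrable_diff integrable_mult_right integrable_mult_left)
  have val: "(LBINT r. ?f k r) = pi * G 0 / (real k + 1) - 2 * pi * laplace_trunc (pole_height k)" for k
    unfolding f_eq
    by (subst Bochner_Integration.integral_diff)
       (use int1 intC in \<open>simp_all only: integrable_mult_right integrable_mult_left integral_mult_right_zero
          integral_mult_left_zero integral_cos_transform integral_cos_transform_cauchy pole_height_pos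
          laplace_trunc_def, simp\<close>)
  have summ: "summable (\<lambda>k. norm (?f k r))" for r
  proof (rule summable_comparison_test'[of _ 0])
    show "summable (\<lambda>k. K * (r\<^sup>2 * 4 * (1 / (pole_height k)\<^sup>2) + 3 / 2 * (1 / ((real k + 1) * pole_height k))))"
      by (intro summable_mult summable_add summable_pole_height)
  next
    fix k :: nat
    have a: "pole_height k > 0" by simp
    have "K / (1 + r\<^sup>2) \<le> K" using mult_left_mono[of 1 "1 + r\<^sup>2" K] K(1) by (simp add: divide_le_eq add_pos_nonneg)
    then have cK: "\<bar>cos_transform r\<bar> \<le> K" using K(2)[of r] by linarith
    have "r\<^sup>2 / ((pole_height k)\<^sup>2 + r\<^sup>2) / (real k + 1) \<le> r\<^sup>2 / (pole_height k)\<^sup>2"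
    proof -
      have "r\<^sup>2 / (((pole_height k)\<^sup>2 + r\<^sup>2) * (real k + 1)) \<le> r\<^sup>2 / ((pole_height k)\<^sup>2 * 1)"
        using a add_pos_nonneg[OF zero_less_power[OF a, of 2] zero_le_power2[of r]] order_less_imp_not_eq2[OF a]
        by (intro divide_left_mono mult_mono mult_pos_pos) auto
      then show ?thesis by simp
    qed
    also have "\<dots> \<le> r\<^sup>2 * 4 * (1 / (pole_height k)\<^sup>2)"
      by (simp add: divide_right_mono)
    finally have "\<bar>h_term k r\<bar> \<le> r\<^sup>2 * 4 * (1 / (pole_height k)\<^sup>2) + 3 / 2 * (1 / ((real k + 1) * pole_height k))"
      using h_term_bound[of k r] a by (simp add: add_divide_distrib mult_ac)
    with cK K(1) show "norm (norm (?f k r)) \<le> K * (r\<^sup>2 * 4 * (1 / (pole_height k)\<^sup>2) + 3 / 2 * (1 / ((real k + 1) * pole_height k)))"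
      unfolding real_norm_def abs_abs abs_mult by (intro mult_mono) auto
  qed
  have "summable (\<lambda>k. LBINT r. norm (?f k r))"
  proof (rule summable_comparison_test'[of _ 0])
    show "summable (\<lambda>k. K * pi * (5 / 2) * (1 / ((real k + 1) * pole_height k)))"
      by (intro summable_mult summable_pole_height)
  next
    fix k :: nat
    let ?a = "pole_height k"
    have a: "?a > 0" by simp
    let ?g = "\<lambda>r. K / (real k + 1) * (1 / (?a\<^sup>2 + r\<^sup>2)) + K * (3 / (2 * ?a)) / (real k + 1) * (1 / (1\<^sup>2 + r\<^sup>2))"
    have g: "integrable lborel ?g"
      using a by (intro Bochner_Integration.integrable_add integrable_mult_right cauchy_integral) auto
    have "norm (?f k r) \<le> ?g r" for r
    proof -
      have "\<bar>cos_transform r\<bar> * \<bar>h_term k r\<bar> \<le> K / (1 + r\<^sup>2) * ((r\<^sup>2 / (?a\<^sup>2 + r\<^sup>2) + 3 / (2 * ?a)) / (real k + 1))"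
        using K by (intro mult_mono h_term_bound) auto
      also have "\<dots> = K / (real k + 1) * ((r\<^sup>2 / (1 + r\<^sup>2)) * (1 / (?a\<^sup>2 + r\<^sup>2))) + K * (3 / (2 * ?a)) / (real k + 1) * (1 / (1\<^sup>2 + r\<^sup>2))"
        by (simp add: distrib_left add_divide_distrib mult_ac)
      also have "\<dots> \<le> ?g r"
      proof -
        have "r\<^sup>2 / (1 + r\<^sup>2) \<le> 1" by (simp add: divide_le_eq add_pos_nonneg)
        then have "(r\<^sup>2 / (1 + r\<^sup>2)) * (1 / (?a\<^sup>2 + r\<^sup>2)) \<le> 1 / (?a\<^sup>2 + r\<^sup>2)"
          by (intro mult_left_le_one_le) auto
        then show ?thesis using K(1) by (intro add_right_mono mult_left_mono) auto
      qed
      finally show ?thesis by (simp add: abs_mult)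
    qed
    then have "(LBINT r. norm (?f k r)) \<le> (LBINT r. ?g r)"
      using int g by (intro integral_mono integrable_norm)
    also have "\<dots> = K / (real k + 1) * (pi / ?a) + K * (3 / (2 * ?a)) / (real k + 1) * (pi / 1)"
      using cauchy_integral[OF a] cauchy_integral[of 1]
      by (subst Bochner_Integration.integral_add)
         (simp_all only: integrable_mult_right integral_mult_right_zero zero_less_one)
    also have "\<dots> = K * pi * (5 / 2) * (1 / ((real k + 1) * ?a))"
      using a by (simp add: divide_simps)
    finally show "norm (LBINT r. norm (?f k r)) \<le> K * pi * (5 / 2) * (1 / ((real k + 1) * pole_height k))"
      by simp
  qed
  note facts = int AE_I2[OF summ] this
  have suminf: "(\<Sum>k. ?f k r) = cos_transform r * (h_plus r + euler_mascheroni + ln pi)" for r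
    using sums_mult[OF h_plus_sums, of "cos_transform r" r] by (simp add: sums_iff)
  have eq: "h_plus r * cos_transform r = (\<Sum>k. ?f k r) - (euler_mascheroni + ln pi) * cos_transform r" for r
    unfolding suminf by (simp add: algebra_simps)
  show "integrable lborel (\<lambda>r. h_plus r * cos_transform r)"
    unfolding eq using int1 by (intro Bochner_Integration.integrable_diff integrable_suminf facts integrable_mult_right)
  have "(LBINT r. h_plus r * cos_transform r) = (LBINT r. \<Sum>k. ?f k r) - (euler_mascheroni + ln pi) * (pi * G 0)"
    unfolding eq using int1
    by (subst Bochner_Integration.integral_diff)
       (auto intro!: integrable_suminf facts simp: integral_cos_transform)
  with sums_integral[OF facts]
  show "(\<lambda>k. pi * G 0 / (real k + 1) - 2 * pi * laplace_trunc (pole_height k)) sums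
      ((LBINT r. h_plus r * cos_transform r) + (euler_mascheroni + ln pi) * (pi * G 0))"
    unfolding val by simp
qed

text \<open>Linear vanishing at \<open>0\<close> compensates the pole of \<open>exp (y / 2) / (exp y - exp (- y))\<close> there.\<close>

lemma trunc_near_zero: "\<exists>M\<ge>0. \<forall>y\<ge>0. \<bar>trunc y - G 0 * exp (- (y / 2))\<bar> \<le> M * y"
proof -
  let ?g = "\<lambda>y. G y - G 0 * exp (- (y / 2))" and ?g' = "\<lambda>y. G' y + G 0 * exp (- (y / 2)) / 2"
  have "compact ((\<lambda>y. \<bar>?g' y\<bar>) ` {0..L})"
    by (intro compact_continuous_image continuous_intros) auto
  from bounded_imp_bdd_above[OF compact_imp_bounded[OF this]]
  obtain B where B: "\<And>y. y \<in> {0..L} \<Longrightarrow> \<bar>?g' y\<bar> \<le> B"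
    unfolding bdd_above_def by blast
  have B0: "B \<ge> 0" using B[of 0] L_pos by auto
  let ?M = "B + \<bar>G 0\<bar> / L"
  have "\<bar>trunc y - G 0 * exp (- (y / 2))\<bar> \<le> ?M * y" if y: "y \<ge> 0" for y
  proof (cases "y \<le> L")
    case True
    have "norm (?g y - ?g 0) \<le> B * norm (y - 0)"
    proof (rule field_differentiable_bound[of "{0..L}" ?g ?g'])
      fix x assume "x \<in> {0..L}"
      show "(?g has_real_derivative ?g' x) (at x within {0..L})"
        by (auto intro!: derivative_eq_intros DERIV_subset[OF G_deriv])
    qed (use B True y in auto)
    then have "\<bar>trunc y - G 0 * exp (- (y / 2))\<bar> \<le> B * y" using True y by (simp add: trunc_def)
    also have "\<dots> \<le> ?M * y" using y L_pos by (intro mult_right_mono) auto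
    finally show ?thesis .
  next
    case False
    have "\<bar>trunc y - G 0 * exp (- (y / 2))\<bar> \<le> \<bar>G 0\<bar>"
      using False y by (simp add: trunc_def abs_mult mult_left_le)
    also have "\<bar>G 0\<bar> \<le> \<bar>G 0\<bar> / L * y" using False L_pos by (simp add: field_simps mult_right_mono)
    also have "\<dots> \<le> ?M * y" using B0 y by (intro mult_right_mono) auto
    finally show ?thesis .
  qed
  moreover have "?M \<ge> 0" using B0 L_pos by auto
  ultimately show ?thesis by blast
qed

text \<open>Termwise integration of the geometric series. Separately, neither the exponential moments nor the
  subtracted terms \<open>1 / (2 k + 1)\<close> need be summable; together the terms are bounded by a multiple
  of \<open>1 / a\<^sup>2\<close>, the integral of \<open>y * exp (- a * y)\<close>.\<close>

lemma weil_kernel_integral: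
  shows "set_integrable lborel {0<..} (\<lambda>y. (trunc y - G 0 * exp (- (y / 2))) * (exp (y / 2) / (exp y - exp (- y))))"
    and "(\<lambda>k. laplace_trunc (pole_height k) - G 0 / (2 * real k + 1)) sums
      (LBINT y:{0<..}. (trunc y - G 0 * exp (- (y / 2))) * (exp (y / 2) / (exp y - exp (- y))))"
proof -
  obtain M where M: "M \<ge> 0" "\<And>y. y \<ge> 0 \<Longrightarrow> \<bar>trunc y - G 0 * exp (- (y / 2))\<bar> \<le> M * y"
    using trunc_near_zero by blast
  let ?d = "\<lambda>y. trunc y - G 0 * exp (- (y / 2))"
  let ?f = "\<lambda>k y. indicator {0<..} y *\<^sub>R (?d y * exp (- (pole_height k * y)))"
  have bound: "norm (?f k y) \<le> M * (indicator {0<..} y * (y * exp (- (pole_height k * y))))" for k y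
    using M by (auto simp: indicator_def abs_mult mult.assoc[symmetric] intro!: mult_right_mono)
  have gint: "integrable lborel (\<lambda>y. M * (indicator {0<..} y * (y * exp (- (pole_height k * y)))))" for k
    by (intro integrable_mult_right linear_exp_integral) simp
  have int: "integrable lborel (?f k)" for k
  proof (rule Bochner_Integration.integrable_bound[OF gint[of k]])
    show "AE y in lborel. norm (?f k y) \<le> norm (M * (indicator {0<..} y * (y * exp (- (pole_height k * y)))))"
      by (intro AE_I2 order.trans[OF bound]) simp
  qed measurable
  have sums: "(\<lambda>k. ?f k y) sums (indicator {0<..} y *\<^sub>R (?d y * (exp (y / 2) / (exp y - exp (- y)))))" for y
    using weil_kernel_sums[of y, THEN sums_mult, of "?d y"] by (cases "y > 0") auto
  have summ: "summable (\<lambda>k. norm (?f k y))" for y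
  proof (cases "y > 0")
    case True
    have "summable (\<lambda>k. \<bar>?d y\<bar> * exp (- (pole_height k * y)))"
      using weil_kernel_sums[OF True] by (intro summable_mult) (auto simp: sums_iff)
    then show ?thesis using True by (simp add: abs_mult)
  qed auto
  have "summable (\<lambda>k. LBINT y. norm (?f k y))"
  proof (rule summable_comparison_test'[of _ 0])
    show "summable (\<lambda>k. M * (1 / (pole_height k)\<^sup>2))"
      by (intro summable_mult summable_pole_height)
    fix k :: nat
    have "(LBINT y. norm (?f k y)) \<le> (LBINT y. M * (indicator {0<..} y * (y * exp (- (pole_height k * y)))))"
      using bound by (intro integral_mono integrable_norm int gint)
    also have "\<dots> = M * (1 / (pole_height k)\<^sup>2)"
      using linear_exp_integral(2)[of "pole_height k"] by simp
    finally show "norm (LBINT y. norm (?f k y)) \<le> M * (1 / (pole_height k)\<^sup>2)" by simp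
  qed
  note facts = int AE_I2[OF summ] this
  have suminf: "(\<Sum>k. ?f k y) = indicator {0<..} y *\<^sub>R (?d y * (exp (y / 2) / (exp y - exp (- y))))" for y
    using sums[of y] by (simp add: sums_iff)
  show "set_integrable lborel {0<..} (\<lambda>y. ?d y * (exp (y / 2) / (exp y - exp (- y))))"
    using integrable_suminf[OF facts] unfolding suminf set_integrable_def .
  have "(LBINT y. ?f k y) = laplace_trunc (pole_height k) - G 0 / (2 * real k + 1)" for k
  proof -
    let ?a = "pole_height k"
    have e: "integrable lborel (\<lambda>y. indicat_real {0<..} y *\<^sub>R exp (- ((?a + 1 / 2) * y)))"
      "(LBINT y. indicat_real {0<..} y *\<^sub>R exp (- ((?a + 1 / 2) * y))) = 1 / (2 * real k + 1)"
      using laplace_cos[of "?a + 1 / 2" 0] pole_height_pos[of k]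
      by (auto simp: set_integrable_def set_lebesgue_integral_def pole_height_def power2_eq_square)
    have g: "integrable lborel (\<lambda>y. indicat_real {0..L} y *\<^sub>R (G y * exp (- (?a * y))))"
      by (intro borel_integrable_compact continuous_intros) auto
    have "(LBINT y. ?f k y) = (LBINT y. indicat_real {0..L} y *\<^sub>R (G y * exp (- (?a * y)))
        - G 0 * (indicat_real {0<..} y *\<^sub>R exp (- ((?a + 1 / 2) * y))))"
    proof (rule integral_cong_AE)
      show "AE y in lborel. ?f k y = indicat_real {0..L} y *\<^sub>R (G y * exp (- (?a * y)))
        - G 0 * (indicat_real {0<..} y *\<^sub>R exp (- ((?a + 1 / 2) * y)))"
        using AE_lborel_singleton[of 0]
        by eventually_elim (auto simp: indicator_def trunc_def algebra_simps exp_add[symmetric] exp_diff[symmetric] mult_exp_exp)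
    qed measurable
    also have "\<dots> = laplace_trunc ?a - G 0 * (1 / (2 * real k + 1))"
      using e g by (simp add: laplace_trunc_def set_lebesgue_integral_def)
    finally show ?thesis by simp
  qed
  with sums_integral[OF facts] suminf
  show "(\<lambda>k. laplace_trunc (pole_height k) - G 0 / (2 * real k + 1)) sums
      (LBINT y:{0<..}. ?d y * (exp (y / 2) / (exp y - exp (- y))))"
    by (simp add: set_lebesgue_integral_def)
qed

text \<open>Adding the two expansions cancels the exponential moments, and only
  \<open>G 0 * (1 / (2 k + 2) - 1 / (2 k + 1))\<close> survives. This is the alternating harmonic series; its sum
  \<open>- G 0 * ln 2\<close> turns the constant \<open>ln \<pi>\<close> of \<open>h_plus\<close> into the \<open>ln (4 \<pi>)\<close> of the functional.\<close>

theorem archimedean_explicit_formula: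
  "1 / (2 * pi) * (LBINT r. h_plus r * cos_transform r) =
    - ((ln (4 * pi) + euler_mascheroni) * (G 0 / 2) +
       (LBINT y:{0<..}. (trunc y - G 0 * exp (- (y / 2))) * (exp (y / 2) / (exp y - exp (- y)))))"
    (is "1 / (2 * pi) * ?X = - (_ + ?Y)")
proof -
  have 1: "(\<lambda>k. G 0 / (2 * real k + 2) - laplace_trunc (pole_height k)) sums
      (1 / (2 * pi) * ?X + (euler_mascheroni + ln pi) * (G 0 / 2))"
  proof -
    have "(\<lambda>k. 1 / (2 * pi) * (pi * G 0 / (real k + 1) - 2 * pi * laplace_trunc (pole_height k))) sums
      (1 / (2 * pi) * (?X + (euler_mascheroni + ln pi) * (pi * G 0)))"
      by (intro sums_mult h_plus_transform)
    moreover have "1 / (2 * pi) * (pi * G 0 / (real k + 1) - 2 * pi * laplace_trunc (pole_height k))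
        = G 0 / (2 * real k + 2) - laplace_trunc (pole_height k)" for k
      by (simp add: right_diff_distrib distrib_left[symmetric])
    moreover have "1 / (2 * pi) * (?X + (euler_mascheroni + ln pi) * (pi * G 0))
        = 1 / (2 * pi) * ?X + (euler_mascheroni + ln pi) * (G 0 / 2)"
      by (simp add: distrib_left)
    ultimately show ?thesis by simp
  qed
  have 2: "(\<lambda>k. - G 0 * (inverse (real (2 * k + 1)) - inverse (real (2 * k + 2)))) sums (- G 0 * ln 2)"
    by (intro sums_mult alternating_harmonic_series_sums')
  have eq: "- G 0 * (inverse (real (2 * k + 1)) - inverse (real (2 * k + 2)))
     = (G 0 / (2 * real k + 2) - laplace_trunc (pole_height k)) + (laplace_trunc (pole_height k) - G 0 / (2 * real k + 1))" for k
    by (simp add: divide_inverse algebra_simps)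
  have "- G 0 * ln 2 = 1 / (2 * pi) * ?X + (euler_mascheroni + ln pi) * (G 0 / 2) + ?Y"
    using sums_unique2[OF 2[unfolded eq] sums_add[OF 1 weil_kernel_integral(2)]] .
  moreover have "ln (4 * pi) = 2 * ln 2 + ln pi"
    using ln_mult[of 4 pi] ln_realpow[of 2 2] by simp
  ultimately show ?thesis by (simp add: algebra_simps)
qed

end

section \<open>Correlations of the exponentials\<close>

text \<open>This is the divided difference at \<open>(m, n)\<close> of \<open>x \<mapsto> sin (2 \<pi> x (1 - y / L)) / \<pi>\<close>, simplified by
  periodicity at integers. It is kept as an explicit formula for all real \<open>y\<close> so that it is smooth
  across \<open>0\<close> and \<open>L\<close>.\<close>

definition fold_corr :: "real \<Rightarrow> int \<Rightarrow> int \<Rightarrow> real \<Rightarrow> real" where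
  "fold_corr L m n y =
     (if m = n then 2 * (1 - y / L) * cos (2 * pi * n * y / L)
      else (sin (2 * pi * m * y / L) - sin (2 * pi * n * y / L)) / (pi * (n - m)))"

lemma fold_corr_vanishing:
  assumes "L > 0"
  shows "\<exists>G' G''. vanishing_at_endpoint (fold_corr L m n) G' G'' L"
proof (cases "m = n")
  case True
  define b where "b = 2 * pi * n / L"
  have eq: "fold_corr L m n = (\<lambda>y. 2 * (1 - y / L) * cos (b * y))"
    using True by (simp add: fold_corr_def b_def fun_eq_iff)
  have "vanishing_at_endpoint (fold_corr L m n)
      (\<lambda>y. - 2 / L * cos (b * y) - 2 * (1 - y / L) * (b * sin (b * y)))
      (\<lambda>y. 4 / L * (b * sin (b * y)) - 2 * (1 - y / L) * (b * b * cos (b * y))) L"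
  proof
    show "((\<lambda>y. - 2 / L * cos (b * y) - 2 * (1 - y / L) * (b * sin (b * y))) has_real_derivative
      4 / L * (b * sin (b * y)) - 2 * (1 - y / L) * (b * b * cos (b * y))) (at y)" for y
      using assms by (auto intro!: derivative_eq_intros simp: field_simps)
    show "(fold_corr L m n has_real_derivative - 2 / L * cos (b * y) - 2 * (1 - y / L) * (b * sin (b * y))) (at y)" for y
      unfolding eq using assms by (auto intro!: derivative_eq_intros simp: field_simps)
  qed (use assms eq in \<open>auto intro!: continuous_intros\<close>)
  then show ?thesis by blast
next
  case False
  define a b where "a = 2 * pi * m / L" "b = 2 * pi * n / L"
  define d where "d = pi * (real_of_int n - real_of_int m)"
  have d: "d \<noteq> 0" using False by (simp add: d_def)
  have eq: "fold_corr L m n = (\<lambda>y. (sin (a * y) - sin (b * y)) / d)"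
    using False by (simp add: fold_corr_def a_b_def d_def fun_eq_iff)
  have "vanishing_at_endpoint (fold_corr L m n)
      (\<lambda>y. (a * cos (a * y) - b * cos (b * y)) / d)
      (\<lambda>y. (b * b * sin (b * y) - a * a * sin (a * y)) / d) L"
  proof
    show "((\<lambda>y. (a * cos (a * y) - b * cos (b * y)) / d) has_real_derivative
      (b * b * sin (b * y) - a * a * sin (a * y)) / d) (at y)" for y
      using d by (auto intro!: derivative_eq_intros simp: field_simps)
    show "(fold_corr L m n has_real_derivative (a * cos (a * y) - b * cos (b * y)) / d) (at y)" for y
      unfolding eq using d by (auto intro!: derivative_eq_intros simp: field_simps)
    show "fold_corr L m n L = 0"
      using assms by (simp add: eq a_b_def)
  qed (use assms d in \<open>auto intro!: continuous_intros\<close>)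
  then show ?thesis by blast
qed

lemma U_cis:
  "U L n t = (if t \<in> {0..L} then of_real (L powr (- 1 / 2)) * cis (2 * pi * n / L * t) else 0)"
  by (simp add: U_def cis_conv_exp mult_ac)

lemma U_measurable [measurable]: "U L n \<in> borel_measurable borel"
proof -
  have [measurable]: "(\<lambda>t. cis (2 * pi * n / L * t)) \<in> borel_measurable borel"
    by (intro borel_measurable_continuous_onI continuous_intros)
  show ?thesis unfolding U_cis by measurable
qed

lemma powr_half_square:
  fixes L :: real
  assumes "L > 0"
  shows "L powr (- 1 / 2) * L powr (- 1 / 2) = 1 / L"
  using assms by (simp add: powr_add[symmetric] powr_minus_divide)

lemma corr_integrand_bound:
  assumes "L > 0"
  shows "norm (cnj (U L m t) * U L n (t + y)) \<le> indicator {0..L} t * (1 / L)"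
  using powr_half_square[OF assms] by (auto simp: U_cis norm_mult indicator_def)

lemma borel_measurable_cnj [measurable]: "cnj \<in> borel_measurable borel"
  by (intro borel_measurable_continuous_onI continuous_intros)

lemma corr_integrable:
  assumes "L > 0"
  shows "integrable lborel (\<lambda>t. cnj (U L m t) * U L n (t + y))"
proof (rule Bochner_Integration.integrable_bound)
  show "integrable lborel (\<lambda>t. indicat_real {0..L} t * (1 / L))"
    by (intro integrable_mult_left integrable_real_indicator) (auto simp: emeasure_lborel_Icc_eq)
  show "AE t in lborel. norm (cnj (U L m t) * U L n (t + y)) \<le> norm (indicat_real {0..L} t * (1 / L))"
    using assms by (intro AE_I2 order.trans[OF corr_integrand_bound[OF assms]]) (simp add: indicator_def)
qed measurable

lemma corr_measurable [measurable]: "corr (U L m) (U L n) \<in> borel_measurable borel"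
  unfolding corr_def by measurable

lemma corr_bound:
  assumes "L > 0"
  shows "norm (corr (U L m) (U L n) y) \<le> 1"
proof -
  have "norm (corr (U L m) (U L n) y) \<le> (LBINT t. indicat_real {0..L} t * (1 / L))"
    unfolding corr_def
    by (intro Bochner_Integration.integral_norm_bound_integral corr_integrable assms corr_integrand_bound
        integrable_mult_left integrable_real_indicator) (auto simp: emeasure_lborel_Icc_eq)
  also have "\<dots> = 1" using assms by simp
  finally show ?thesis .
qed

lemma corr_outside:
  assumes "\<bar>y\<bar> > L"
  shows "corr (U L m) (U L n) y = 0"
proof -
  have "cnj (U L m t) * U L n (t + y) = 0" for t
    using assms by (auto simp: U_cis)
  then show ?thesis unfolding corr_def by (simp only: Bochner_Integration.integral_zero)
qed

lemma corr_uminus: "corr f g (- y) = cnj (corr g f y)"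
proof -
  have "corr f g (- y) = (LBINT t. cnj (f (t + y)) * g t)"
    using lborel_integral_real_affine[of 1 "\<lambda>t. cnj (f t) * g (t - y)" y]
    by (simp add: corr_def add.commute)
  also have "\<dots> = (LBINT t. cnj (cnj (g t) * f (t + y)))"
    by (simp add: mult.commute)
  also have "\<dots> = cnj (corr g f y)"
    unfolding corr_def by (rule Bochner_Integration.integral_cnj)
  finally show ?thesis .
qed

text \<open>On the overlap \<open>[0, L - y]\<close> of the two supports the integrand is a single exponential of frequency
  \<open>n - m\<close>.\<close>

lemma corr_U:
  assumes "L > 0" "0 \<le> y" "y \<le> L"
  shows "corr (U L m) (U L n) y =
    (if m = n then of_real (1 - y / L) * cis (2 * pi * n * y / L)
     else (cis (2 * pi * m * y / L) - cis (2 * pi * n * y / L)) / (2 * pi * \<i> * (of_int n - of_int m)))"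
proof -
  define b where "b = 2 * pi * (real_of_int n - real_of_int m) / L"
  define e where "e = cis (2 * pi * n * y / L) / of_real L"
  have eq: "cnj (U L m t) * U L n (t + y) = indicator {0..L - y} t *\<^sub>R (e * cis (b * t))" for t
  proof (cases "t \<in> {0..L - y}")
    case True
    then have "cnj (U L m t) * U L n (t + y) =
      of_real (L powr (- 1 / 2) * L powr (- 1 / 2)) * (cis (- (2 * pi * m / L * t)) * cis (2 * pi * n / L * (t + y)))"
      using assms by (simp add: U_cis cis_cnj mult_ac)
    also have "\<dots> = of_real (1 / L) * cis (2 * pi * n * y / L + b * t)"
      unfolding powr_half_square[OF assms(1)] cis_mult
      by (simp add: b_def algebra_simps diff_divide_distrib add_divide_distrib)
    finally show ?thesis using True by (simp add: e_def cis_mult[symmetric])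
  next
    case False
    then show ?thesis using assms by (auto simp: U_cis)
  qed
  show ?thesis
  proof (cases "m = n")
    case True
    have "corr (U L m) (U L n) y = (LBINT t. indicator {0..L - y} t *\<^sub>R e)"
      unfolding corr_def eq using True by (simp add: b_def)
    also have "\<dots> = (L - y) *\<^sub>R e" using assms by simp
    also have "\<dots> = of_real (1 - y / L) * cis (2 * pi * n * y / L)"
      using assms by (simp add: e_def scaleR_conv_of_real field_simps)
    finally show ?thesis using True by simp
  next
    case False
    then have b: "b \<noteq> 0" using assms by (simp add: b_def)
    have "corr (U L m) (U L n) y = e * cis (b * (L - y)) / (\<i> * b) - e * cis (b * 0) / (\<i> * b)"
      unfolding corr_def eq
    proof (rule integral_FTC_atLeastAtMost)
      fix t
      have "((\<lambda>z. e * exp (\<i> * (of_real b * z)) / (\<i> * b)) has_field_derivative e * exp (\<i> * (of_real b * of_real t))) (at (of_real t))"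
        using b by (auto intro!: derivative_eq_intros simp: algebra_simps)
      from has_vector_derivative_real_field[OF this]
      show "((\<lambda>t. e * cis (b * t) / (\<i> * b)) has_vector_derivative e * cis (b * t)) (at t within {0..L - y})"
        by (simp add: cis_conv_exp)
    qed (use assms in \<open>auto intro!: continuous_intros\<close>)
    also have "\<dots> = (e * cis (b * (L - y)) - e) / (\<i> * b)"
      by (simp add: diff_divide_distrib)
    also have "e * cis (b * (L - y)) = cis (2 * pi * m * y / L) / L"
    proof -
      have "2 * pi * n * y / L + b * (L - y) = 2 * pi * m * y / L + 2 * pi * of_int (n - m)"
        using assms by (simp add: b_def field_simps)
      then have "cis (2 * pi * n * y / L) * cis (b * (L - y)) = cis (2 * pi * m * y / L) * cis (2 * pi * of_int (n - m))"
        by (simp only: cis_mult)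
      also have "cis (2 * pi * of_int (n - m)) = 1"
        using cis_multiple_2pi[of "of_int (n - m)"] by (simp add: mult_ac)
      finally show ?thesis by (simp add: e_def)
    qed
    also have "(cis (2 * pi * m * y / L) / L - e) / (\<i> * b) =
       (cis (2 * pi * m * y / L) - cis (2 * pi * n * y / L)) / (2 * pi * \<i> * (of_int n - of_int m))"
      unfolding e_def diff_divide_distrib[symmetric] using assms by (simp add: b_def)
    finally show ?thesis using False by simp
  qed
qed

text \<open>The value at \<open>- y\<close> is the conjugate of the correlation with \<open>m\<close> and \<open>n\<close> exchanged. In the sum the
  cosine parts cancel for \<open>m \<noteq> n\<close> and the sine parts for \<open>m = n\<close>, which makes it real.\<close>

lemma corr_fold:
  assumes "L > 0" "0 \<le> y"
  shows "corr (U L m) (U L n) y + corr (U L m) (U L n) (- y)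
    = of_real (if y \<le> L then fold_corr L m n y else 0)"
proof (cases "y \<le> L")
  case True
  let ?s = "corr (U L m) (U L n) y + corr (U L m) (U L n) (- y)"
  have s: "?s = corr (U L m) (U L n) y + cnj (corr (U L n) (U L m) y)"
    by (simp add: corr_uminus)
  show ?thesis
  proof (cases "m = n")
    case True
    then show ?thesis
      unfolding s using assms \<open>y \<le> L\<close>
      by (simp add: corr_U fold_corr_def complex_eq_iff algebra_simps)
  next
    case False
    define d where "d = (of_int n - of_int m :: complex)"
    have d: "d \<noteq> 0" using False by (simp add: d_def)
    let ?a = "2 * pi * m * y / L" and ?b = "2 * pi * n * y / L"
    have "cnj ((cis ?b - cis ?a) / (2 * pi * \<i> * (of_int m - of_int n))) = (cis (- ?b) - cis (- ?a)) / (2 * pi * \<i> * d)"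
      by (simp add: cis_cnj d_def right_diff_distrib)
    then have "?s = (cis ?a - cis ?b + (cis (- ?b) - cis (- ?a))) / (2 * pi * \<i> * d)"
      unfolding s using assms \<open>y \<le> L\<close> False by (simp add: corr_U d_def add_divide_distrib)
    also have "cis ?a - cis ?b + (cis (- ?b) - cis (- ?a)) = 2 * \<i> * of_real (sin ?a - sin ?b)"
      by (simp add: complex_eq_iff)
    also have "2 * \<i> * of_real (sin ?a - sin ?b) / (2 * pi * \<i> * d) = of_real ((sin ?a - sin ?b) / (pi * (n - m)))"
      using d by (simp add: d_def)
    finally show ?thesis using True False by (simp add: fold_corr_def)
  qed
next
  case False
  then show ?thesis using assms by (simp add: corr_outside)
qed

lemma corr_at_0:
  assumes "L > 0"
  shows "corr (U L m) (U L n) 0 = of_real (fold_corr L m n 0 / 2)"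
  using corr_fold[OF assms, of 0 m n] assms by (simp add: field_simps)

section \<open>The matrices as integrals and sums of folded correlations\<close>

lemma fold_corr_cont: "L > 0 \<Longrightarrow> continuous_on A (fold_corr L m n)"
  by (cases "m = n") (auto simp: fold_corr_def[abs_def] intro!: continuous_intros)

lemma sin_int_reflect: "sin (2 * pi * of_int k * (1 - y / L)) = - sin (2 * pi * of_int k * y / L)"
  and cos_int_reflect: "cos (2 * pi * of_int k * (1 - y / L)) = cos (2 * pi * of_int k * y / L)"
  by (simp_all add: right_diff_distrib sin_diff cos_diff cos_int_2pin[simplified mult.commute mult.assoc])

text \<open>Passing to divided differences is linear in \<open>\<psi>\<close>, also on the diagonal, where it means
  differentiating under the integral. Every continuous superposition of the sines therefore
  becomes the same superposition of folded correlations.\<close>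

lemma Q_of_sine_integral:
  assumes "L > 0" and w: "continuous_on {0..L} w"
  shows "Q_of (\<lambda>x. integral {0..L} (\<lambda>y. w y * sin (2 * pi * x * (1 - y / L)))) m n
    = pi * integral {0..L} (\<lambda>y. w y * fold_corr L m n y)"
proof -
  have i: "(\<lambda>y. w y * sin (2 * pi * x * (1 - y / L))) integrable_on {0..L}" for x
    using assms by (intro integrable_continuous_interval continuous_intros) auto
  show ?thesis
  proof (cases "m = n")
    case True
    have "((\<lambda>x. integral (cbox 0 L) (\<lambda>y. w y * sin (2 * pi * x * (1 - y / L)))) has_real_derivative
        integral (cbox 0 L) (\<lambda>y. w y * (cos (2 * pi * of_int m * (1 - y / L)) * (2 * pi * (1 - y / L))))) (at (of_int m) within UNIV)"
    proof (rule leibniz_rule_field_derivative)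
      show "continuous_on (UNIV \<times> cbox 0 L) (\<lambda>(x, y). w y * (cos (2 * pi * x * (1 - y / L)) * (2 * pi * (1 - y / L))))"
        unfolding split_def using assms
        by (intro continuous_intros continuous_on_compose2[OF w]) auto
    qed (use i in \<open>auto intro!: derivative_eq_intros\<close>)
    then have "deriv (\<lambda>x. integral {0..L} (\<lambda>y. w y * sin (2 * pi * x * (1 - y / L)))) (of_int m)
       = integral {0..L} (\<lambda>y. w y * (cos (2 * pi * of_int m * (1 - y / L)) * (2 * pi * (1 - y / L))))"
      by (auto intro: DERIV_imp_deriv)
    also have "\<dots> = integral {0..L} (\<lambda>y. pi * (w y * fold_corr L m n y))"
      using True unfolding cos_int_reflect by (simp add: fold_corr_def mult_ac)
    finally show ?thesis using True by (simp add: Q_of_def)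
  next
    case False
    then have d: "real_of_int m - real_of_int n \<noteq> 0" by simp
    have "integral {0..L} (\<lambda>y. w y * sin (2 * pi * of_int m * (1 - y / L))) -
        integral {0..L} (\<lambda>y. w y * sin (2 * pi * of_int n * (1 - y / L)))
      = integral {0..L} (\<lambda>y. w y * sin (2 * pi * of_int m * (1 - y / L)) - w y * sin (2 * pi * of_int n * (1 - y / L)))"
      by (intro Henstock_Kurzweil_Integration.integral_diff[symmetric] i)
    also have "\<dots> = integral {0..L} (\<lambda>y. pi * (of_int m - of_int n) * (w y * fold_corr L m n y))"
    proof (rule Henstock_Kurzweil_Integration.integral_cong)
      fix y
      have "pi * (of_int m - of_int n) * fold_corr L m n y
          = - (sin (2 * pi * of_int m * y / L) - sin (2 * pi * of_int n * y / L))"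
        using False by (simp add: fold_corr_def field_simps)
      then have "w y * (pi * (of_int m - of_int n) * fold_corr L m n y)
         = w y * - (sin (2 * pi * of_int m * y / L) - sin (2 * pi * of_int n * y / L))" by simp
      then show "w y * sin (2 * pi * of_int m * (1 - y / L)) - w y * sin (2 * pi * of_int n * (1 - y / L))
          = pi * (of_int m - of_int n) * (w y * fold_corr L m n y)"
        unfolding sin_int_reflect by (simp add: algebra_simps)
    qed
    also have "\<dots> = pi * (of_int m - of_int n) * integral {0..L} (\<lambda>y. w y * fold_corr L m n y)"
      by simp
    finally show ?thesis using False d by (simp add: Q_of_def)
  qed
qed

lemma Q_prime_eq:
  assumes "L > 0"
  shows "Q_prime c L m n = - (\<Sum>q | primepow q \<and> real q \<le> c.
         mangoldt q / sqrt (real q) * fold_corr L m n (ln (real q)))"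
proof -
  let ?P = "{q. primepow q \<and> real q \<le> c}"
  let ?c = "\<lambda>q. mangoldt q / sqrt (real q)"
  show ?thesis
  proof (cases "m = n")
    case True
    have "(psi_prime c L has_real_derivative - (1 / pi) * (\<Sum>q\<in>?P. ?c q * (cos (2 * pi * of_int m * (1 - ln (real q) / L)) * (2 * pi * (1 - ln (real q) / L))))) (at (of_int m))"
      unfolding psi_prime_def[abs_def]
      by (intro DERIV_cmult DERIV_sum) (auto intro!: derivative_eq_intros)
    from DERIV_imp_deriv[OF this] True show ?thesis
      unfolding cos_int_reflect by (simp add: Q_prime_def Q_of_def fold_corr_def sum_distrib_left sum_negf mult_ac)
  next
    case False
    have fc: "fold_corr L m n y = - (sin (2 * pi * of_int m * y / L) - sin (2 * pi * of_int n * y / L)) / (pi * (of_int m - of_int n))" for y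
      using False by (simp add: fold_corr_def field_simps)
    have "psi_prime c L (of_int m) - psi_prime c L (of_int n)
      = - (1 / pi) * (\<Sum>q\<in>?P. ?c q * - (sin (2 * pi * of_int m * ln (real q) / L) - sin (2 * pi * of_int n * ln (real q) / L)))"
      unfolding psi_prime_def sin_int_reflect right_diff_distrib[symmetric] sum_subtractf[symmetric]
      by (simp add: algebra_simps)
    then show ?thesis using False
      by (simp add: Q_prime_def Q_of_def fc sum_divide_distrib sum_negf mult.assoc)
  qed
qed

lemma Q_pole_eq:
  assumes "L > 0"
  shows "Q_pole L m n = (LBINT y:{0..L}. 2 * cosh (y / 2) * fold_corr L m n y)"
proof -
  have "psi_pole L x = integral {0..L} (\<lambda>y. 2 * cosh (y / 2) / pi * sin (2 * pi * x * (1 - y / L)))" for x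
  proof -
    have "(LBINT y:{0..L}. 2 * cosh (y / 2) * sin (2 * pi * x * (1 - y / L))) = integral {0..L} (\<lambda>y. 2 * cosh (y / 2) * sin (2 * pi * x * (1 - y / L)))"
      using assms by (intro set_borel_integral_eq_integral borel_integrable_atLeastAtMost' continuous_intros) auto
    then show ?thesis by (simp add: psi_pole_def)
  qed
  then have psi: "psi_pole L = (\<lambda>x. integral {0..L} (\<lambda>y. 2 * cosh (y / 2) / pi * sin (2 * pi * x * (1 - y / L))))"
    by (rule ext)
  have "Q_pole L m n = pi * integral {0..L} (\<lambda>y. 2 * cosh (y / 2) / pi * fold_corr L m n y)"
    unfolding Q_pole_def psi using assms by (intro Q_of_sine_integral continuous_intros) auto
  also have "\<dots> = integral {0..L} (\<lambda>y. 2 * cosh (y / 2) * fold_corr L m n y)"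
    by simp
  also have "\<dots> = (LBINT y:{0..L}. 2 * cosh (y / 2) * fold_corr L m n y)"
    using assms by (intro set_borel_integral_eq_integral(2)[symmetric] borel_integrable_atLeastAtMost' continuous_intros fold_corr_cont) auto
  finally show ?thesis .
qed

lemma h_plus_cont: "continuous_on A h_plus"
proof -
  have "continuous_on A (\<lambda>r. Digamma (1 / 4 + \<i> * complex_of_real r / 2))"
  proof (rule continuous_on_compose2[OF continuous_on_Polygamma[of "{z. Re z > 0}"]])
    show "{z. 0 < Re z} \<inter> \<int>\<^sub>\<le>\<^sub>0 = {}"
      by (auto elim!: nonpos_Ints_cases)
  qed (auto intro!: continuous_intros)
  then show ?thesis unfolding h_plus_def[abs_def] by (intro continuous_intros)
qed

lemma h_plus_cont_intros [continuous_intros]: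
  "continuous_on A f \<Longrightarrow> continuous_on A (\<lambda>x. h_plus (f x))"
  by (auto intro: continuous_on_compose2[OF h_plus_cont])

text \<open>For finite \<open>T\<close> the integrals over \<open>r\<close> and \<open>y\<close> can be exchanged, which brings \<open>psi_arch\<close> into the
  form of a superposition of sines; exchanging them back leaves the cosine transform of the folded
  correlation against \<open>h_plus\<close>.\<close>

lemma Q_arch_eq:
  assumes "L > 0"
  shows "Q_arch L T m n =
    1 / (2 * pi) * (LBINT r:{-T..T}. h_plus r * integral {0..L} (\<lambda>y. fold_corr L m n y * cos (r * y)))"
proof -
  define w where "w = (\<lambda>y. 1 / (2 * pi\<^sup>2) * integral {-T..T} (\<lambda>r. h_plus r * cos (r * y)))"
  have c1: "continuous_on A (\<lambda>y. integral (cbox (-T) T) (\<lambda>r. h_plus r * cos (r * y)))" for A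
    by (rule integral_continuous_on_param) (auto intro!: continuous_intros simp: split_def)
  then have w_cont: "continuous_on A w" for A
    unfolding w_def by (auto intro!: continuous_intros)
  have fold_cont: "continuous_on A (\<lambda>x. fold_corr L m n (f x))" if "continuous_on A f" for A and f :: "'b :: topological_space \<Rightarrow> real"
    using continuous_on_compose2[OF fold_corr_cont[OF assms, of UNIV] that] by auto
  have swap: "integral {-T..T} (\<lambda>r. h_plus r * integral {0..L} (\<lambda>y. g y * cos (r * y)))
      = integral {0..L} (\<lambda>y. integral {-T..T} (\<lambda>r. h_plus r * cos (r * y)) * g y)"
    if g: "\<And>A f. continuous_on A f \<Longrightarrow> continuous_on A (\<lambda>x :: real \<times> real. g (f x))" for g
  proof -
    have "integral (cbox (-T) T) (\<lambda>r. integral (cbox 0 L) (\<lambda>y. h_plus r * (g y * cos (r * y))))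
       = integral (cbox 0 L) (\<lambda>y. integral (cbox (-T) T) (\<lambda>r. h_plus r * (g y * cos (r * y))))"
      by (rule integral_swap_continuous) (auto intro!: continuous_intros g simp: split_def)
    moreover have "(\<lambda>y. integral {-T..T} (\<lambda>r. h_plus r * (g y * cos (r * y))))
      = (\<lambda>y. integral {-T..T} (\<lambda>r. h_plus r * cos (r * y)) * g y)"
      by (subst integral_mult_left[symmetric]) (simp add: mult_ac)
    ultimately show ?thesis by simp
  qed
  have "psi_arch L T x = integral {0..L} (\<lambda>y. w y * sin (2 * pi * x * (1 - y / L)))" for x
  proof -
    have S: "S_kernel r x L = integral {0..L} (\<lambda>y. sin (2 * pi * x * (1 - y / L)) * cos (r * y))" for r
      unfolding S_kernel_def using assms
      by (intro set_borel_integral_eq_integral borel_integrable_atLeastAtMost' continuous_intros) auto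
    have "continuous_on UNIV (\<lambda>r. integral (cbox 0 L) (\<lambda>y. sin (2 * pi * x * (1 - y / L)) * cos (r * y)))"
      using assms by (intro integral_continuous_on_param) (auto intro!: continuous_intros simp: split_def)
    then have "(LBINT r:{-T..T}. h_plus r * S_kernel r x L) = integral {-T..T} (\<lambda>r. h_plus r * S_kernel r x L)"
      unfolding S
      by (intro set_borel_integral_eq_integral borel_integrable_atLeastAtMost' continuous_intros)
         (auto intro: continuous_on_subset)
    also have "\<dots> = integral {0..L} (\<lambda>y. integral {-T..T} (\<lambda>r. h_plus r * cos (r * y)) * sin (2 * pi * x * (1 - y / L)))"
      unfolding S using assms by (intro swap) (auto intro!: continuous_intros)
    finally show ?thesis by (simp add: psi_arch_def w_def mult.assoc)
  qed
  then have psi: "psi_arch L T = (\<lambda>x. integral {0..L} (\<lambda>y. w y * sin (2 * pi * x * (1 - y / L))))"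
    by (rule ext)
  have "Q_arch L T m n = pi * integral {0..L} (\<lambda>y. w y * fold_corr L m n y)"
    unfolding Q_arch_def psi using assms by (intro Q_of_sine_integral w_cont)
  also have "\<dots> = pi * (1 / (2 * pi\<^sup>2) * integral {0..L} (\<lambda>y. integral {-T..T} (\<lambda>r. h_plus r * cos (r * y)) * fold_corr L m n y))"
    by (simp add: w_def mult.assoc)
  also have "\<dots> = 1 / (2 * pi) * integral {-T..T} (\<lambda>r. h_plus r * integral {0..L} (\<lambda>y. fold_corr L m n y * cos (r * y)))"
    using assms by (subst swap) (auto intro!: fold_cont simp: power2_eq_square)
  also have "integral {-T..T} (\<lambda>r. h_plus r * integral {0..L} (\<lambda>y. fold_corr L m n y * cos (r * y)))
    = (LBINT r:{-T..T}. h_plus r * integral {0..L} (\<lambda>y. fold_corr L m n y * cos (r * y)))"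
  proof -
    have "continuous_on UNIV (\<lambda>r. integral (cbox 0 L) (\<lambda>y. fold_corr L m n y * cos (r * y)))"
      by (intro integral_continuous_on_param) (auto intro!: continuous_intros fold_cont simp: split_def)
    then show ?thesis
      by (intro set_borel_integral_eq_integral(2)[symmetric] borel_integrable_atLeastAtMost' continuous_intros)
         (auto intro: continuous_on_subset)
  qed
  finally show ?thesis .
qed

section \<open>Logarithmic coordinates\<close>

lemma exp_substitution:
  fixes f :: "real \<Rightarrow> complex"
  assumes [measurable]: "f \<in> borel_measurable borel" "S \<in> sets borel" "exp ` S \<in> sets borel"
    and int: "set_integrable lborel S (\<lambda>y. exp y *\<^sub>R f (exp y))"
  shows "set_integrable lborel (exp ` S) f"
    and "(LBINT x:exp ` S. f x) = (LBINT y:S. exp y *\<^sub>R f (exp y))"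
proof -
  have A: "(\<lambda>x. indicator (exp ` S) x *\<^sub>R f x) \<in> borel_measurable lborel"
    and B: "(\<lambda>y. indicator S y *\<^sub>R (exp y *\<^sub>R f (exp y))) \<in> borel_measurable lborel"
    by measurable
  have "(\<lambda>y. exp y *\<^sub>R f (exp y)) absolutely_integrable_on S"
    using int integrable_completion[OF B] by (simp add: set_integrable_def)
  then have "(\<lambda>y. \<bar>exp y\<bar> *\<^sub>R f (exp y)) absolutely_integrable_on S \<and>
      integral S (\<lambda>y. \<bar>exp y\<bar> *\<^sub>R f (exp y)) = integral S (\<lambda>y. exp y *\<^sub>R f (exp y))"
    by simp
  then have 1: "f absolutely_integrable_on exp ` S \<and> integral (exp ` S) f = integral S (\<lambda>y. exp y *\<^sub>R f (exp y))"
    by (subst (asm) has_absolute_integral_change_of_variables_real)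
       (auto intro!: derivative_eq_intros inj_onI)
  then show 2: "set_integrable lborel (exp ` S) f"
    using integrable_completion[OF A] by (simp add: set_integrable_def)
  show "(LBINT x:exp ` S. f x) = (LBINT y:S. exp y *\<^sub>R f (exp y))"
    using 1 set_borel_integral_eq_integral(2)[OF 2] set_borel_integral_eq_integral(2)[OF int] by simp
qed

lemma exp_image_UNIV: "exp ` (UNIV :: real set) = {0<..}"
proof -
  have "x \<in> range exp" if "x > 0" for x :: real
    using that by (metis exp_ln rangeI)
  then show ?thesis by auto
qed

lemma exp_image_pos: "exp ` {0<..} = {1::real<..}"
proof -
  have "x \<in> exp ` {0<..}" if "x > 1" for x :: real
    using that by (intro image_eqI[of _ _ "ln x"]) auto
  then show ?thesis by auto
qed

text \<open>The open half-line avoids counting the point \<open>0\<close> twice and matches the range \<open>x > 1\<close> after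
  exponentiating.\<close>

lemma LBINT_fold:
  fixes k :: "real \<Rightarrow> complex"
  assumes "integrable lborel k"
  shows "(LBINT y. k y) = (LBINT y:{0<..}. k y + k (- y))"
proof -
  have [measurable]: "k \<in> borel_measurable borel" using assms by auto
  have i1: "integrable lborel (\<lambda>y. indicator {0<..} y *\<^sub>R k y)"
    and i2: "integrable lborel (\<lambda>y. indicator {..<0} y *\<^sub>R k y)"
    using assms by (auto intro!: integrable_mult_indicator)
  have i3: "integrable lborel (\<lambda>y. indicator {0<..} y *\<^sub>R k (- y))"
    and e3: "(LBINT y. indicator {..<0} y *\<^sub>R k y) = (LBINT y. indicator {0<..} y *\<^sub>R k (- y))"
    using lborel_integrable_real_affine[OF i2, of "-1" 0]
      lborel_integral_real_affine[of "-1" "\<lambda>y. indicator {..<0} y *\<^sub>R k y" 0]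
    by (simp_all add: indicator_def)
  have "(LBINT y. k y) = (LBINT y. indicator {0<..} y *\<^sub>R k y + indicator {..<0} y *\<^sub>R k y)"
  proof (rule integral_cong_AE)
    show "AE y in lborel. k y = indicator {0<..} y *\<^sub>R k y + indicator {..<0} y *\<^sub>R k y"
      using AE_lborel_singleton[of 0] by eventually_elim (auto simp: indicator_def)
  qed measurable
  also have "\<dots> = (LBINT y. indicator {0<..} y *\<^sub>R k y + indicator {0<..} y *\<^sub>R k (- y))"
    using i1 i2 i3 e3 by simp
  finally show ?thesis by (simp add: set_lebesgue_integral_def scaleR_add_right)
qed

section \<open>The three functionals on the basis correlations\<close>

lemma corr_mult_measurable [measurable]: "corr_mult (U L m) (U L n) \<in> borel_measurable borel"
  unfolding corr_mult_def by measurable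

text \<open>Integrability is recorded along with the value because the extension to trigonometric polynomials
  splits the integral over finitely many basis correlations.\<close>

lemma W_pole_U:
  fixes L :: real and m n :: int
  assumes "L > 0"
  defines "F \<equiv> corr_mult (U L m) (U L n)"
  shows "set_integrable lborel {0<..} (\<lambda>x. F x * of_real ((x powr (1 / 2) + x powr (- 1 / 2)) / x))"
    and "W_pole F = of_real (Q_pole L m n)"
proof -
  let ?C = "corr (U L m) (U L n)"
  let ?f = "\<lambda>x. F x * of_real ((x powr (1 / 2) + x powr (- 1 / 2)) / x)"
  let ?k = "\<lambda>y. ?C y * of_real (2 * cosh (y / 2))"
  have [measurable]: "F \<in> borel_measurable borel" unfolding F_def by measurable
  have eq: "exp y *\<^sub>R ?f (exp y) = ?k y" for y
    by (simp add: F_def corr_mult_def powr_def scaleR_conv_of_real cosh_def field_simps)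
  have [measurable]: "(\<lambda>y::real. cosh (y / 2)) \<in> borel_measurable borel" "fold_corr L m n \<in> borel_measurable borel"
    using assms by (auto intro!: borel_measurable_continuous_onI continuous_intros fold_corr_cont)
  have int: "integrable lborel ?k"
  proof (rule Bochner_Integration.integrable_bound)
    show "integrable lborel (\<lambda>y. indicator {-L..L} y *\<^sub>R (2 * cosh (y / 2)))"
      by (intro borel_integrable_compact continuous_intros) auto
    show "?k \<in> borel_measurable lborel" by measurable
    show "AE y in lborel. norm (?k y) \<le> norm (indicator {-L..L} y *\<^sub>R (2 * cosh (y / 2)))"
    proof (intro AE_I2)
      fix y
      show "norm (?k y) \<le> norm (indicator {-L..L} y *\<^sub>R (2 * cosh (y / 2)))"
      proof (cases "\<bar>y\<bar> \<le> L")
        case True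
        then have "y \<in> {-L..L}" by auto
        with corr_bound[OF assms(1), of m n y] show ?thesis
          by (simp add: norm_mult mult_left_le_one_le)
      qed (use corr_outside in auto)
    qed
  qed
  have "set_integrable lborel UNIV (\<lambda>y. exp y *\<^sub>R ?f (exp y))"
    unfolding eq using int by (simp add: set_integrable_def)
  moreover have "?f \<in> borel_measurable borel" "(UNIV :: real set) \<in> sets borel" "exp ` (UNIV :: real set) \<in> sets borel"
    by (measurable, simp_all add: exp_image_UNIV)
  ultimately have subst: "set_integrable lborel (exp ` UNIV) ?f"
      "(LBINT x:exp ` UNIV. ?f x) = (LBINT y:UNIV. exp y *\<^sub>R ?f (exp y))"
    using exp_substitution[of ?f UNIV] by blast+
  then show "set_integrable lborel {0<..} ?f" by (simp add: exp_image_UNIV)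
  have "W_pole F = (LBINT y. ?k y)"
    using subst(2) unfolding eq by (simp add: W_pole_def exp_image_UNIV set_lebesgue_integral_def)
  also have "\<dots> = (LBINT y:{0<..}. ?k y + ?k (- y))"
    by (rule LBINT_fold[OF int])
  also have "\<dots> = (LBINT y. of_real (indicator {0..L} y * (2 * cosh (y / 2) * fold_corr L m n y)))"
    unfolding set_lebesgue_integral_def
  proof (rule integral_cong_AE)
    show "AE y in lborel. indicator {0<..} y *\<^sub>R (?k y + ?k (- y)) =
       complex_of_real (indicator {0..L} y * (2 * cosh (y / 2) * fold_corr L m n y))"
      using AE_lborel_singleton[of 0]
    proof eventually_elim
      case (elim y)
      show ?case
      proof (cases "y > 0")
        case True
        have "?k y + ?k (- y) = (?C y + ?C (- y)) * of_real (2 * cosh (y / 2))"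
          by (simp add: algebra_simps)
        also have "\<dots> = complex_of_real (indicator {0..L} y * (2 * cosh (y / 2) * fold_corr L m n y))"
          using True corr_fold[OF assms(1), of y m n] by (simp add: indicator_def)
        finally show ?thesis using True by simp
      qed (use elim in \<open>auto simp: indicator_def\<close>)
    qed
  qed measurable
  also have "\<dots> = of_real (Q_pole L m n)"
    unfolding Q_pole_eq[OF assms(1)] by (subst integral_complex_of_real) (simp add: set_lebesgue_integral_def)
  finally show "W_pole F = of_real (Q_pole L m n)" .
qed

text \<open>The convergence of \<open>Q_arch\<close> comes from the absolute integrability of \<open>h_plus\<close> times the cosine
  transform, and identifies the otherwise unspecified limit \<open>Q_arch_inf\<close> with the full integral. After
  \<open>x = exp y\<close> the functional is the other side of the explicit formula, since the value at \<open>x = 1\<close> is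
  half the folded correlation at \<open>0\<close>.\<close>

lemma W_real_U:
  fixes L :: real and m n :: int
  assumes "L > 0"
  defines "F \<equiv> corr_mult (U L m) (U L n)"
  shows "set_integrable lborel {1<..}
      (\<lambda>x. (F x + F (inverse x) - 2 * of_real (x powr (- 1 / 2)) * F 1) * of_real (x powr (1 / 2) / (x - inverse x) / x))"
    and "((\<lambda>T. Q_arch L T m n) \<longlongrightarrow> Q_arch_inf L m n) at_top"
    and "W_real F = of_real (- Q_arch_inf L m n)"
proof -
  obtain G' G'' where "vanishing_at_endpoint (fold_corr L m n) G' G'' L"
    using fold_corr_vanishing[OF assms(1)] by blast
  then interpret vanishing_at_endpoint "fold_corr L m n" G' G'' L .
  let ?C = "corr (U L m) (U L n)"
  let ?f = "\<lambda>x. (F x + F (inverse x) - 2 * of_real (x powr (- 1 / 2)) * F 1) * of_real (x powr (1 / 2) / (x - inverse x) / x)"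
  let ?k = "\<lambda>y. (trunc y - fold_corr L m n 0 * exp (- (y / 2))) * (exp (y / 2) / (exp y - exp (- y)))"
  have [measurable]: "F \<in> borel_measurable borel" unfolding F_def by measurable
  have F1: "F 1 = of_real (fold_corr L m n 0 / 2)"
    using corr_at_0[OF assms(1)] by (simp add: F_def corr_mult_def)
  have eq: "exp y *\<^sub>R ?f (exp y) = of_real (?k y)" if "y > 0" for y
  proof -
    have "F (exp y) + F (inverse (exp y)) = of_real (trunc y)"
      using corr_fold[OF assms(1), of y m n] that by (simp add: F_def corr_mult_def trunc_def ln_inverse)
    moreover have "2 * complex_of_real (exp y powr (- 1 / 2)) * F 1 = of_real (fold_corr L m n 0 * exp (- (y / 2)))"
      by (simp add: F1 powr_def)
    ultimately show ?thesis
      by (simp add: powr_def scaleR_conv_of_real exp_minus[symmetric] del: of_real_mult of_real_diff of_real_divide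
          flip: of_real_mult of_real_diff of_real_divide)
  qed
  have k: "set_integrable lborel {0<..} (\<lambda>y. complex_of_real (?k y))"
    using integrable_of_real[OF weil_kernel_integral(1)[unfolded set_integrable_def], where 'a = complex]
    by (simp add: set_integrable_def scaleR_conv_of_real)
  have "set_integrable lborel {0<..} (\<lambda>y. exp y *\<^sub>R ?f (exp y))"
    using k eq by (subst set_integrable_cong[OF refl refl]) auto
  moreover have "?f \<in> borel_measurable borel" "{0::real<..} \<in> sets borel" "exp ` {0::real<..} \<in> sets borel"
    by (measurable, simp_all add: exp_image_pos)
  ultimately have subst: "set_integrable lborel (exp ` {0<..}) ?f"
      "(LBINT x:exp ` {0<..}. ?f x) = (LBINT y:{0<..}. exp y *\<^sub>R ?f (exp y))"
    using exp_substitution[of ?f "{0<..}"] by blast+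
  then show "set_integrable lborel {1<..} ?f" by (simp add: exp_image_pos)
  have "(LBINT x:{1<..}. ?f x) = (LBINT y:{0<..}. complex_of_real (?k y))"
    unfolding exp_image_pos[symmetric] subst(2)
    by (rule set_lebesgue_integral_cong, simp, intro allI impI, rule eq, simp)
  also have "\<dots> = of_real (LBINT y:{0<..}. ?k y)"
    unfolding set_lebesgue_integral_def integral_complex_of_real[symmetric] by (simp add: scaleR_conv_of_real)
  finally have "W_real F = of_real ((ln (4 * pi) + euler_mascheroni) * (fold_corr L m n 0 / 2) + (LBINT y:{0<..}. ?k y))"
    by (simp add: W_real_def F1)
  also have "(ln (4 * pi) + euler_mascheroni) * (fold_corr L m n 0 / 2) + (LBINT y:{0<..}. ?k y)
    = - (1 / (2 * pi) * (LBINT r. h_plus r * cos_transform r))"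
    using archimedean_explicit_formula by linarith
  finally have W: "W_real F = of_real (- (1 / (2 * pi) * (LBINT r. h_plus r * cos_transform r)))" .
  have lim: "((\<lambda>T. Q_arch L T m n) \<longlongrightarrow> 1 / (2 * pi) * (LBINT r. h_plus r * cos_transform r)) at_top"
    unfolding Q_arch_eq[OF assms(1)] cos_transform_def[symmetric]
    by (intro tendsto_mult tendsto_const tendsto_LBINT_symmetric h_plus_transform)
  then have "Q_arch_inf L m n = 1 / (2 * pi) * (LBINT r. h_plus r * cos_transform r)"
    unfolding Q_arch_inf_def by (intro tendsto_Lim) auto
  with lim W show "((\<lambda>T. Q_arch L T m n) \<longlongrightarrow> Q_arch_inf L m n) at_top"
     "W_real F = of_real (- Q_arch_inf L m n)" by simp_all
qed

lemma finite_primepows_le: "finite {q :: nat. primepow q \<and> real q \<le> c}"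
proof (rule finite_subset)
  show "{q :: nat. primepow q \<and> real q \<le> c} \<subseteq> {..nat \<lfloor>c\<rfloor>}"
    by (auto simp: le_nat_floor)
qed simp

lemma W_prime_finite:
  assumes "\<And>x. x > c \<Longrightarrow> F x = 0 \<and> F (inverse x) = 0"
  shows "W_prime F = (\<Sum>q | primepow q \<and> real q \<le> c.
     of_real (mangoldt q / sqrt (real q)) * (F (real q) + F (inverse (real q))))"
proof -
  have "W_prime F = (\<Sum>\<^sub>\<infinity>q\<in>{q. primepow q \<and> real q \<le> c}.
     of_real (mangoldt q / sqrt (real q)) * (F (real q) + F (inverse (real q))))"
    unfolding W_prime_def by (rule infsum_cong_neutral) (use assms in auto)
  then show ?thesis by (simp add: finite_primepows_le)
qed

lemma corr_mult_outside:
  assumes "c > 1" "L = ln c" "x > c"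
  shows "corr_mult (U L m) (U L n) x = 0" "corr_mult (U L m) (U L n) (inverse x) = 0"
proof -
  have "ln x > L" using assms by simp
  then have "\<bar>ln x\<bar> > L" "\<bar>ln (inverse x)\<bar> > L" using assms by (auto simp: ln_inverse)
  then show "corr_mult (U L m) (U L n) x = 0" "corr_mult (U L m) (U L n) (inverse x) = 0"
    unfolding corr_mult_def by (auto intro: corr_outside)
qed

text \<open>A prime power exceeds \<open>1\<close>, so its logarithm lies in the range where the folding identity holds; prime
  powers beyond \<open>c\<close> lie outside the support of the correlation.\<close>

lemma W_prime_U:
  assumes "c > 1" "L = ln c"
  shows "W_prime (corr_mult (U L m) (U L n)) = of_real (- Q_prime c L m n)"
proof -
  have L: "L > 0" using assms by simp
  have "corr_mult (U L m) (U L n) (real q) + corr_mult (U L m) (U L n) (inverse (real q)) = of_real (fold_corr L m n (ln (real q)))"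
    if "primepow q" "real q \<le> c" for q
  proof -
    have "real q > 1" using primepow_gt_Suc_0[OF that(1)] by simp
    then have "ln (real q) \<ge> 0" "ln (real q) \<le> L" "ln (inverse (real q)) = - ln (real q)"
      using that assms by (auto simp: ln_inverse)
    then show ?thesis using corr_fold[OF L, of "ln (real q)" m n] by (simp add: corr_mult_def)
  qed
  then show ?thesis
    unfolding Q_prime_eq[OF L]
    by (subst W_prime_finite[of c]) (use corr_mult_outside[OF assms] in auto)
qed

section \<open>Bilinear extension to trigonometric polynomials\<close>

lemma W_pole_sum:
  assumes "\<And>p. p \<in> I \<Longrightarrow> set_integrable lborel {0<..} (\<lambda>x. \<Phi> p x * of_real ((x powr (1 / 2) + x powr (- 1 / 2)) / x))"
  shows "W_pole (\<lambda>x. \<Sum>p\<in>I. a p * \<Phi> p x) = (\<Sum>p\<in>I. a p * W_pole (\<Phi> p))"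
proof -
  have "W_pole (\<lambda>x. \<Sum>p\<in>I. a p * \<Phi> p x)
    = (LBINT x. \<Sum>p\<in>I. a p * (indicator {0<..} x *\<^sub>R (\<Phi> p x * of_real ((x powr (1 / 2) + x powr (- 1 / 2)) / x))))"
    unfolding W_pole_def set_lebesgue_integral_def
    by (simp only: sum_distrib_right scaleR_right.sum mult.assoc mult_scaleR_right)
  also have "\<dots> = (\<Sum>p\<in>I. a p * W_pole (\<Phi> p))"
    using assms unfolding W_pole_def set_lebesgue_integral_def set_integrable_def
    by (subst Bochner_Integration.integral_sum)
       (simp_all only: integrable_mult_right integral_mult_right_zero)
  finally show ?thesis .
qed

lemma W_real_sum:
  assumes "\<And>p. p \<in> I \<Longrightarrow> set_integrable lborel {1<..}
      (\<lambda>x. (\<Phi> p x + \<Phi> p (inverse x) - 2 * of_real (x powr (- 1 / 2)) * \<Phi> p 1) * of_real (x powr (1 / 2) / (x - inverse x) / x))"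
  shows "W_real (\<lambda>x. \<Sum>p\<in>I. a p * \<Phi> p x) = (\<Sum>p\<in>I. a p * W_real (\<Phi> p))"
proof -
  let ?f = "\<lambda>p x. (\<Phi> p x + \<Phi> p (inverse x) - 2 * of_real (x powr (- 1 / 2)) * \<Phi> p 1) * of_real (x powr (1 / 2) / (x - inverse x) / x)"
  have *: "(\<Sum>p\<in>I. a p * \<Phi> p x) + (\<Sum>p\<in>I. a p * \<Phi> p (inverse x)) - 2 * of_real (x powr (- 1 / 2)) * (\<Sum>p\<in>I. a p * \<Phi> p 1)
     = (\<Sum>p\<in>I. a p * (\<Phi> p x + \<Phi> p (inverse x) - 2 * of_real (x powr (- 1 / 2)) * \<Phi> p 1))" for x
    unfolding sum_distrib_left sum.distrib[symmetric] sum_subtractf[symmetric]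
    by (intro sum.cong refl) (simp add: algebra_simps)
  have "(LBINT x:{1<..}. ((\<Sum>p\<in>I. a p * \<Phi> p x) + (\<Sum>p\<in>I. a p * \<Phi> p (inverse x)) - 2 * of_real (x powr (- 1 / 2)) * (\<Sum>p\<in>I. a p * \<Phi> p 1)) * of_real (x powr (1 / 2) / (x - inverse x) / x))
    = (LBINT x. \<Sum>p\<in>I. a p * (indicator {1<..} x *\<^sub>R ?f p x))"
    unfolding * set_lebesgue_integral_def
    by (simp only: sum_distrib_right scaleR_right.sum mult.assoc mult_scaleR_right)
  also have "\<dots> = (\<Sum>p\<in>I. a p * (LBINT x:{1<..}. ?f p x))"
    using assms unfolding set_lebesgue_integral_def set_integrable_def
    by (subst Bochner_Integration.integral_sum)
       (simp_all only: integrable_mult_right integral_mult_right_zero)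
  moreover have e: "of_real (ln (4 * pi) + euler_mascheroni) * (\<Sum>p\<in>I. a p * \<Phi> p 1)
      = (\<Sum>p\<in>I. a p * (of_real (ln (4 * pi) + euler_mascheroni) * \<Phi> p 1))"
    unfolding sum_distrib_left by (simp only: mult.left_commute)
  ultimately show ?thesis
    by (simp only: W_real_def distrib_left sum.distrib)
qed

lemma corr_trig_poly:
  assumes "L > 0"
  shows "corr (trig_poly N L v) (trig_poly N L v) y =
    (\<Sum>p\<in>idx N \<times> idx N. of_real (sym_coeff v (fst p) * sym_coeff v (snd p)) * corr (U L (fst p)) (U L (snd p)) y)"
proof -
  have "cnj (trig_poly N L v t) * trig_poly N L v (t + y) =
      (\<Sum>p\<in>idx N \<times> idx N. of_real (sym_coeff v (fst p) * sym_coeff v (snd p)) * (cnj (U L (fst p) t) * U L (snd p) (t + y)))" for t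
    unfolding trig_poly_def cnj_sum sum_product sum.cartesian_product
    by (intro sum.cong) auto
  then show ?thesis
    unfolding corr_def using corr_integrable[OF assms]
    by (simp only: Bochner_Integration.integral_sum integrable_mult_right integral_mult_right_zero)
qed

lemma quad_form_pairs:
  "quad_form N v Q = (\<Sum>p\<in>idx N \<times> idx N. sym_coeff v (fst p) * sym_coeff v (snd p) * Q (fst p) (snd p))"
  by (simp add: quad_form_def sum.cartesian_product split_def)

theorem lemma2p1:
  fixes c L :: real and N :: nat
  assumes "c > 1" and "L = ln c"
  shows
    "(\<forall>m\<in>idx N. \<forall>n\<in>idx N. ((\<lambda>T. Q_arch L T m n) \<longlongrightarrow> Q_arch_inf L m n) at_top) \<and>
     (\<forall>v :: nat \<Rightarrow> real.
        let F = corr_mult (trig_poly N L v) (trig_poly N L v)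
        in complex_of_real (quad_form N v (Q_inf c L)) = W_pole F - W_real F - W_prime F) \<and>
     (\<forall>m\<in>idx N. \<forall>n\<in>idx N.
        let F = corr_mult (U L m) (U L n)
        in complex_of_real (- Q_prime c L m n) = W_prime F \<and>
           complex_of_real (Q_pole L m n) = W_pole F \<and>
           complex_of_real (- Q_arch_inf L m n) = W_real F)"
proof -
  have L: "L > 0" using assms by simp
  note blocks = W_prime_U[OF assms] W_pole_U(2)[OF L] W_real_U(3)[OF L]
  have "complex_of_real (quad_form N v (Q_inf c L)) = W_pole F - W_real F - W_prime F"
    if "F = corr_mult (trig_poly N L v) (trig_poly N L v)" for v F
  proof -
    let ?I = "idx N \<times> idx N"
    define a where "a = (\<lambda>p. complex_of_real (sym_coeff v (fst p) * sym_coeff v (snd p)))"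
    define \<Phi> where "\<Phi> = (\<lambda>p. corr_mult (U L (fst p)) (U L (snd p)))"
    have F: "F = (\<lambda>x. \<Sum>p\<in>?I. a p * \<Phi> p x)"
      unfolding that a_def \<Phi>_def corr_mult_def by (rule ext) (rule corr_trig_poly[OF L])
    have zero: "\<Phi> p x = 0 \<and> \<Phi> p (inverse x) = 0" if "x > c" for p x
      unfolding \<Phi>_def using corr_mult_outside[OF assms that] by simp
    have "W_prime F = (\<Sum>q | primepow q \<and> real q \<le> c.
        of_real (mangoldt q / sqrt (real q)) * (F (real q) + F (inverse (real q))))"
      unfolding F using zero by (intro W_prime_finite) simp
    also have "\<dots> = (\<Sum>q | primepow q \<and> real q \<le> c. \<Sum>p\<in>?I.
        a p * (of_real (mangoldt q / sqrt (real q)) * (\<Phi> p (real q) + \<Phi> p (inverse (real q)))))"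
      unfolding F by (simp only: sum_distrib_left sum.distrib[symmetric] distrib_left mult_ac)
    also have "\<dots> = (\<Sum>p\<in>?I. a p * W_prime (\<Phi> p))"
    proof -
      have "W_prime (\<Phi> p) = (\<Sum>q | primepow q \<and> real q \<le> c.
          of_real (mangoldt q / sqrt (real q)) * (\<Phi> p (real q) + \<Phi> p (inverse (real q))))" for p
        by (rule W_prime_finite) (rule zero)
      then show ?thesis unfolding sum_distrib_left by (subst sum.swap) (simp only: sum_distrib_left)
    qed
    finally have prime: "W_prime F = (\<Sum>p\<in>?I. a p * W_prime (\<Phi> p))" .
    have pole: "W_pole F = (\<Sum>p\<in>?I. a p * W_pole (\<Phi> p))"
      unfolding F by (rule W_pole_sum) (unfold \<Phi>_def, rule W_pole_U(1)[OF L])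
    have real: "W_real F = (\<Sum>p\<in>?I. a p * W_real (\<Phi> p))"
      unfolding F by (rule W_real_sum) (unfold \<Phi>_def, rule W_real_U(1)[OF L])
    show ?thesis
      unfolding prime pole real quad_form_pairs sum_subtractf[symmetric] of_real_sum
      by (intro sum.cong refl) (simp add: a_def \<Phi>_def blocks Q_inf_def algebra_simps)
  qed
  then show ?thesis
    using W_real_U(2)[OF L] blocks by (simp add: Let_def)
qed

end
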